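(* Let $a,b,c$ be integers with $ac(b^2-4ac)\neq 0$. Finding the integral points, i.e. all pairs $(x,y)\in\mathbb{Z}^2$, on the biquadratic curve $$y^2=a x^4+b x^2+c$$ reduces to solving a finite number of quartic Thue equations.
   Context: A quartic Thue equation is an equation $g(m,n)=d$ in integer unknowns $m,n$, where $d$ is a non-zero integer and $g\in\mathbb{Z}[m,n]$ is a homogeneous polynomial of degree $4$. Normally $g$ is required to be irreducible; by convention, the lists of equations produced by a reduction may also include "Thue-like" equations in which $g$ is reducible, provided $g$ is not of the form $\kappa\cdot T(m,n)^2$ with $\kappa$ a constant and $T$ a polynomial (so that the equation still has only finitely many integer solutions). "Finding the solutions of a Diophantine problem reduces to solving a finite number of quartic Thue equations" means: there is an algorithm which, from the data of the problem (here $a,b,c$), produces a finite (possibly empty) list of equations $g(m,n)=d$ in integer unknowns $m,n$, each with $d$ a non-zero integer and $g\in\mathbb{Z}[m,n]$ a homogeneous polynomial of degree $4$ that is either irreducible, or reducible but not of the form $\kappa\cdot T(m,n)^2$ with $\kappa$ a constant and $T$ a polynomial, together with an explicit computable rule assigning to each integer solution $(m,n)$ of each equation in the list a finite set of candidates, such that every solution of the problem occurs among the candidates so obtained. *)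

theory Defs
  imports Complex_Main "HOL-Library.Nat_Bijection" "HOL-Computational_Algebra.Polynomial"
begin

text \<open>Total general recursive functions. A function of arity \<open>n\<close> is applied only to lists of
  length \<open>n\<close>; its values on other lists carry no meaning. Minimisation is restricted to regular
  functions, so every function obtained is total.\<close>

inductive recursive :: "nat \<Rightarrow> (nat list \<Rightarrow> nat) \<Rightarrow> bool" where
  zero: "recursive n (\<lambda>xs. 0)"
| succ: "recursive 1 (\<lambda>xs. Suc (xs ! 0))"
| proj: "i < n \<Longrightarrow> recursive n (\<lambda>xs. xs ! i)"
| comp: "recursive (length gs) f \<Longrightarrow> \<forall>g\<in>set gs. recursive n g \<Longrightarrow>
    recursive n (\<lambda>xs. f (map (\<lambda>g. g xs) gs))"
| prim_rec: "recursive n f \<Longrightarrow> recursive (n + 2) g \<Longrightarrow>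
    recursive (Suc n) (\<lambda>xs. rec_nat (f (tl xs)) (\<lambda>k r. g (k # r # tl xs)) (hd xs))"
| minim: "recursive (Suc n) f \<Longrightarrow> (\<And>xs. length xs = n \<Longrightarrow> \<exists>k. f (k # xs) = 0) \<Longrightarrow>
    recursive n (\<lambda>xs. LEAST k. f (k # xs) = 0)"

text \<open>Effective codings of the data on which algorithms operate; all are built from the
  standard computable bijections of \<^theory>\<open>HOL-Library.Nat_Bijection\<close>.\<close>

class coded =
  fixes code :: "'a \<Rightarrow> nat"
  assumes inj_code: "inj code"

instantiation int :: coded
begin
definition code_int :: "int \<Rightarrow> nat" where "code_int = int_encode"
instance by standard (simp add: code_int_def inj_int_encode)
end

instantiation prod :: (coded, coded) coded
begin
definition code_prod :: "'a \<times> 'b \<Rightarrow> nat" where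
  "code_prod p = prod_encode (code (fst p), code (snd p))"
instance
  by standard (auto simp: inj_def code_prod_def prod_eq_iff dest: injD[OF inj_code])
end

instantiation list :: (coded) coded
begin
definition code_list :: "'a list \<Rightarrow> nat" where
  "code_list xs = list_encode (map code xs)"
instance
  by standard (auto intro!: injI simp: code_list_def list_encode_eq inj_map_eq_map[OF inj_code])
end

instantiation poly :: ("{zero, coded}") coded
begin
definition code_poly :: "'a poly \<Rightarrow> nat" where
  "code_poly p = code (coeffs p)"
instance
  by standard (auto simp: inj_def code_poly_def coeffs_eq_iff dest: injD[OF inj_code])
end

definition computable :: "('a::coded \<Rightarrow> 'b::coded) \<Rightarrow> bool" where
  "computable f \<longleftrightarrow> (\<exists>F. recursive 1 F \<and> (\<forall>x. F [code x] = code (f x)))"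

text \<open>A polynomial in \<open>\<int>[m,n]\<close> is an element of \<open>\<int>[m][n]\<close>: the coefficient of
  \<open>m\<^sup>i n\<^sup>j\<close> in \<open>g\<close> is \<open>coeff (coeff g j) i\<close>.\<close>

definition eval2 :: "'a::comm_ring_1 poly poly \<Rightarrow> 'a \<Rightarrow> 'a \<Rightarrow> 'a" where
  "eval2 g m n = poly (poly g [:n:]) m"

definition homogeneous :: "nat \<Rightarrow> 'a::zero poly poly \<Rightarrow> bool" where
  "homogeneous k g \<longleftrightarrow> g \<noteq> 0 \<and> (\<forall>i j. coeff (coeff g j) i \<noteq> 0 \<longrightarrow> i + j = k)"

abbreviation of_int_poly2 :: "int poly poly \<Rightarrow> 'a::ring_1 poly poly" where
  "of_int_poly2 \<equiv> map_poly (map_poly of_int)"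

definition const_times_square :: "'a::comm_ring_1 poly poly \<Rightarrow> bool" where
  "const_times_square g \<longleftrightarrow> (\<exists>\<kappa> T. g = smult [:\<kappa>:] (T\<^sup>2))"

text \<open>Irreducibility is over \<open>\<rat>\<close>. Excluding the form \<open>\<kappa> T\<^sup>2\<close> over \<open>\<complex>\<close> excludes it over
  every smaller ring of coefficients.\<close>

definition quartic_thue :: "int poly poly \<Rightarrow> int \<Rightarrow> bool" where
  "quartic_thue g d \<longleftrightarrow> d \<noteq> 0 \<and> homogeneous 4 g \<and>
     (irreducible (of_int_poly2 g :: rat poly poly) \<or>
      \<not> irreducible (of_int_poly2 g :: rat poly poly) \<and>
      \<not> const_times_square (of_int_poly2 g :: complex poly poly))"

text \<open>A problem is given by a set \<open>P\<close> of admissible data and, for each datum \<open>p\<close>, its set of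
  solutions \<open>S p\<close>. A single algorithm \<open>eqs\<close> must serve all data, and so must the rule \<open>cand\<close>,
  which sends a datum, an equation and a solution of that equation to a finite list of candidates.
  Totality of both is no restriction when membership in \<open>P\<close> is decidable, because
  \<open>g(m,n) = d\<close> is.\<close>

definition reduces_to_quartic_thue ::
    "'p::coded set \<Rightarrow> ('p \<Rightarrow> 's::coded set) \<Rightarrow> bool" where
  "reduces_to_quartic_thue P S \<longleftrightarrow>
     (\<exists>(eqs :: 'p \<Rightarrow> (int poly poly \<times> int) list)
       (cand :: 'p \<times> (int poly poly \<times> int) \<times> (int \<times> int) \<Rightarrow> 's list).
       computable eqs \<and> computable cand \<and>
       (\<forall>p\<in>P.
          (\<forall>(g, d)\<in>set (eqs p). quartic_thue g d) \<and>
          (\<forall>s\<in>S p. \<exists>(g, d)\<in>set (eqs p). \<exists>m n.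
             eval2 g m n = d \<and> s \<in> set (cand (p, (g, d), (m, n))))))"

end

theory Submission
  imports Defs
begin

text \<open>
  Let \<open>(x, y)\<close> be an integral point of \<open>y\<^sup>2 = a x\<^sup>4 + b x\<^sup>2 + c\<close>. Then \<open>(a x\<^sup>2, a x y)\<close> is an integral
  point of the elliptic curve \<open>Y\<^sup>2 = X (X\<^sup>2 + b X + a c)\<close>, and Mordell's correspondence attaches to it
  the binary quartic form
  \<open>f(t, z) = (t\<^sup>2 - (a x\<^sup>2 + b) z\<^sup>2)\<^sup>2 - a (2 z (x t + y z))\<^sup>2\<close>, here called the covering quartic.
  It has integer coefficients and leading coefficient 1, and its invariants \<open>I\<close> and \<open>J\<close> depend on
  \<open>a, b, c\<close> only; in particular \<open>4 I\<^sup>3 - J\<^sup>2 = 110592 (a c)\<^sup>2 (b\<^sup>2 - 4 a c)\<close> does not vanish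
  (\<open>disc27_covering\<close>). By reduction theory \<open>f\<close> is equivalent under \<open>SL\<^sub>2(\<int>)\<close> to a form \<open>F\<close> whose
  coefficients are bounded in terms of \<open>a, b, c\<close> (\<open>covering_equivalent_to_small\<close>). If
  \<open>F = f \<circ> M\<close> and \<open>(m, n) = M\<^sup>-\<^sup>1 (1, 0)\<close>, then \<open>F(m, n) = f(1, 0) = 1\<close>. Hence every integral point
  gives a solution of one of the finitely many equations \<open>F(m, n) = 1\<close> in which \<open>F\<close> has bounded
  coefficients and \<open>4 I\<^sup>3 \<noteq> J\<^sup>2\<close>. These are quartic Thue equations, because a form \<open>\<kappa> T\<^sup>2\<close> has repeated
  roots and so satisfies \<open>4 I\<^sup>3 = J\<^sup>2\<close> (\<open>quartic_thue_binary_form\<close>).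

  Conversely, the Hessian is a covariant, so its value for \<open>F\<close> at \<open>(m, n)\<close> is its value for \<open>f\<close> at
  \<open>(1, 0)\<close>, which is \<open>48 a x\<^sup>2 + 16 b\<close>. Thus \<open>F\<close> and \<open>(m, n)\<close> determine \<open>x\<^sup>2\<close>. For the list of
  candidates it is enough that this bounds \<open>x\<close> and \<open>y\<close> explicitly (\<open>solution_size\<close>): all pairs of
  integers up to the bound are listed.

  The reduction step does not need to distinguish the possible signatures of \<open>f\<close>. In the coordinates
  \<open>L = x t + y z\<close> and \<open>z\<close> one has
  \<open>x\<^sup>4 f = L\<^sup>4 - 4 y L\<^sup>3 z + (4 b x\<^sup>2 + 6 c) L\<^sup>2 z\<^sup>2 - 4 c y L z\<^sup>3 + c\<^sup>2 z\<^sup>4\<close>,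
  with all coefficients of size \<open>O(x\<^sup>2)\<close>, because \<open>y = O(x\<^sup>2)\<close>. So the positive definite form
  \<open>L\<^sup>2 + z\<^sup>2\<close> of determinant \<open>x\<^sup>2\<close> controls \<open>f\<close>. In a reduced basis, whose vectors have lengths
  \<open>P \<le> Q\<close> with \<open>P Q = O(x)\<close>, the coefficient of \<open>u\<^bsup>4-i\<^esup> v\<^bsup>i\<^esup>\<close> is \<open>O(P\<^bsup>4-i\<^esup> Q\<^bsup>i\<^esup> / x\<^sup>2)\<close>. If \<open>P\<^sup>2\<close> were
  much smaller than \<open>\<bar>x\<bar>\<close>, the first two coefficients would be integers of absolute value less than
  1, hence zero, and the form would have a double root. Therefore \<open>P\<^sup>2\<close> is at least of order \<open>\<bar>x\<bar>\<close>,
  \<open>Q\<^sup>2\<close> is at most of order \<open>\<bar>x\<bar>\<close>, and all coefficients are bounded.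

  Both algorithms enumerate objects by their codes up to an explicit bound, so their computability
  follows from closure properties of the recursive functions (\<open>computable_enumeration\<close>).
\<close>

section \<open>Binary quartic forms, their invariants and the Hessian\<close>

type_synonym 'a quartic = "'a \<times> 'a \<times> 'a \<times> 'a \<times> 'a"

fun eval_quartic :: "'a::comm_ring_1 quartic \<Rightarrow> 'a \<Rightarrow> 'a \<Rightarrow> 'a" where
  "eval_quartic (p, q, r, s, t) u v = p * u^4 + q * u^3 * v + r * u^2 * v^2 + s * u * v^3 + t * v^4"

text \<open>The coefficients of \<open>F(i u + j v, k u + l v)\<close>, written out so that substitution acts on
  coefficient tuples; the columns of the matrix are \<open>(i, k)\<close> and \<open>(j, l)\<close>.\<close>

fun subst_quartic :: "'a::comm_ring_1 \<Rightarrow> 'a \<Rightarrow> 'a \<Rightarrow> 'a \<Rightarrow> 'a quartic \<Rightarrow> 'a quartic" where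
  "subst_quartic i j k l (p, q, r, s, t) =
    (eval_quartic (p, q, r, s, t) i k,
     4*p*i^3*j + q*(3*i^2*j*k + i^3*l) + r*(2*i*j*k^2 + 2*i^2*k*l) + s*(j*k^3 + 3*i*k^2*l) + 4*t*k^3*l,
     6*p*i^2*j^2 + q*(3*i*j^2*k + 3*i^2*j*l) + r*(j^2*k^2 + 4*i*j*k*l + i^2*l^2)
       + s*(3*j*k^2*l + 3*i*k*l^2) + 6*t*k^2*l^2,
     4*p*i*j^3 + q*(3*i*j^2*l + j^3*k) + r*(2*i*j*l^2 + 2*j^2*k*l) + s*(i*l^3 + 3*j*k*l^2) + 4*t*k*l^3,
     eval_quartic (p, q, r, s, t) j l)"

text \<open>The classical invariants of degrees 2 and 3. With this normalisation they are integral for forms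
  written without binomial coefficients.\<close>

fun invariant_I :: "'a::comm_ring_1 quartic \<Rightarrow> 'a" where
  "invariant_I (p, q, r, s, t) = 12*p*t - 3*q*s + r^2"

fun invariant_J :: "'a::comm_ring_1 quartic \<Rightarrow> 'a" where
  "invariant_J (p, q, r, s, t) = 72*p*r*t + 9*q*r*s - 27*p*s^2 - 27*q^2*t - 2*r^3"

text \<open>The Hessian determinant divided by \<open>-3\<close>.\<close>

fun hessian :: "'a::comm_ring_1 quartic \<Rightarrow> 'a quartic" where
  "hessian (p, q, r, s, t) = (3*q^2 - 8*p*r, 4*(q*r - 6*p*s), 2*(2*r^2 - 24*p*t - 3*q*s),
     4*(r*s - 6*q*t), 3*s^2 - 8*r*t)"

lemma eval_quartic_subst:
  fixes i j k l :: "'a :: idom"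
  shows "eval_quartic (subst_quartic i j k l F) u v = eval_quartic F (i*u + j*v) (k*u + l*v)"
  by (induction F rule: prod_induct5, simp only: eval_quartic.simps subst_quartic.simps, algebra)

lemma subst_quartic_comp:
  fixes i j k l :: "'a :: idom"
  shows "subst_quartic i j k l (subst_quartic i' j' k' l' F) =
    subst_quartic (i'*i + j'*k) (i'*j + j'*l) (k'*i + l'*k) (k'*j + l'*l) F"
  by (induction F rule: prod_induct5, simp only: eval_quartic.simps subst_quartic.simps prod.inject, intro conjI; algebra)

lemma invariant_I_subst:
  fixes i j k l :: "'a :: idom"
  shows "invariant_I (subst_quartic i j k l F) = (i*l - j*k)^4 * invariant_I F"
  by (induction F rule: prod_induct5, simp only: eval_quartic.simps subst_quartic.simps invariant_I.simps, algebra)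

lemma invariant_J_subst:
  fixes i j k l :: "'a :: idom"
  shows "invariant_J (subst_quartic i j k l F) = (i*l - j*k)^6 * invariant_J F"
  by (induction F rule: prod_induct5, simp only: eval_quartic.simps subst_quartic.simps invariant_J.simps, algebra)

lemma hessian_subst:
  fixes i j k l :: "'a :: idom"
  shows "eval_quartic (hessian (subst_quartic i j k l F)) u v =
    (i*l - j*k)^2 * eval_quartic (hessian F) (i*u + j*v) (k*u + l*v)"
  by (induction F rule: prod_induct5, simp only: eval_quartic.simps subst_quartic.simps
      hessian.simps, algebra)

text \<open>This is 27 times the discriminant.\<close>

definition disc27 :: "'a::comm_ring_1 quartic \<Rightarrow> 'a" where
  "disc27 F = 4 * invariant_I F ^ 3 - invariant_J F ^ 2"

lemma disc27_subst:
  fixes i :: "'a :: idom" assumes "i*l - j*k = 1" shows "disc27 (subst_quartic i j k l F) = disc27 F"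
  by (simp add: disc27_def invariant_I_subst invariant_J_subst assms)

text \<open>The form is divisible by \<open>v\<^sup>2\<close>, so \<open>(1, 0)\<close> is a double root.\<close>

lemma disc27_double_root: "disc27 (0, 0, r, s, t) = 0"
  by (simp add: disc27_def power_mult_distrib flip: power_mult)

lemma subst_quartic_scale: "subst_quartic i j k l F = (p, q, r, s, t) \<Longrightarrow> F = (p', q', r', s', t') \<Longrightarrow>
   subst_quartic i j k l (e*p', e*q', e*r', e*s', e*t') = (e*p, e*q, e*r, e*s, e*t)"
  by (auto simp: algebra_simps)

lemma subst_quartic_of_int: "subst_quartic i j k l (p, q, r, s, t) = (p', q', r', s', t') \<Longrightarrow>
   subst_quartic (of_int i) (of_int j) (of_int k) (of_int l) (of_int p, of_int q, of_int r, of_int s, of_int t)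
    = (of_int p', of_int q', of_int r', of_int s', (of_int t' :: real))"
  by auto

section \<open>Binary forms as polynomials, and the exclusion of multiples of squares\<close>

fun binary_form :: "'a::zero quartic \<Rightarrow> 'a poly poly" where
  "binary_form (p, q, r, s, t) = [:[:0,0,0,0,p:], [:0,0,0,q:], [:0,0,r:], [:0,s:], [:t:]:]"

lemma eval2_binary_form: "eval2 (binary_form F) m n = eval_quartic F m n"
  by (induction F rule: prod_induct5)
     (simp add: eval2_def algebra_simps eval_nat_numeral)

lemma homogeneous_binary_form:
  assumes "F \<noteq> (0,0,0,0,0)" shows "homogeneous 4 (binary_form F)"
proof (cases F rule: prod_cases5)
  case (fields p q r s t)
  then show ?thesis using assms unfolding homogeneous_def
    by (auto simp: coeff_pCons split: nat.splits)
qed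

lemma degree_le_2E:
  assumes "degree f \<le> 2" obtains u v w where "f = [:u, v, w:]"
proof
  show "f = [:coeff f 0, coeff f 1, coeff f 2:]"
  proof (rule poly_eqI)
    fix n :: nat
    consider "n = 0" | "n = 1" | "n = 2" | "n > 2" by linarith
    then show "coeff f n = coeff [:coeff f 0, coeff f 1, coeff f 2:] n"
      using assms by cases (auto simp: coeff_pCons coeff_eq_0 numeral_2_eq_2 split: nat.splits)
  qed
qed

lemma disc27_of_int: "disc27 (of_int p, of_int q, of_int r, of_int s, of_int t) =
   (of_int (disc27 (p, q, r, s, t)) :: 'a::comm_ring_1)"
  by (simp add: disc27_def)

text \<open>The polynomial \<open>T\<close> need not be given as a homogeneous one. Setting \<open>n = 1\<close> removes this difficulty:
  the coefficients of the form are those of \<open>\<kappa> \<tau>\<^sup>2\<close> with \<open>\<tau>\<close> a polynomial in one variable, of degree at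
  most 2 for \<open>\<kappa> \<noteq> 0\<close>, and the discriminant of such a quartic vanishes identically in the
  coefficients of \<open>\<tau>\<close>.\<close>

lemma disc27_const_times_square:
  assumes "const_times_square (of_int_poly2 (binary_form F) :: complex poly poly)"
  shows "disc27 F = 0"
proof (cases F rule: prod_cases5)
  case (fields p q r s t)
  let ?c = "of_int :: int \<Rightarrow> complex"
  obtain \<kappa> :: complex and T where "of_int_poly2 (binary_form F) = smult [:\<kappa>:] (T\<^sup>2)"
    using assms unfolding const_times_square_def by blast
  then have "poly (of_int_poly2 (binary_form F)) 1 = poly (smult [:\<kappa>:] (T\<^sup>2)) 1" by simp
  then have eq: "[:?c t, ?c s, ?c r, ?c q, ?c p:] = smult \<kappa> ((poly T 1)^2)"
    by (simp add: fields map_poly_pCons)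
  have "disc27 (?c p, ?c q, ?c r, ?c s, ?c t) = 0"
  proof (cases "\<kappa> = 0")
    case True
    then have "?c p = 0" "?c q = 0" using eq by (auto split: if_splits)
    then show ?thesis using disc27_double_root by metis
  next
    case False
    have "degree (smult \<kappa> ((poly T 1)^2)) \<le> 4" unfolding eq[symmetric] by (simp add: degree_pCons_le)
    then have "degree (poly T 1) \<le> 2"
      using False by (cases "poly T 1 = 0") (simp_all add: degree_power_eq)
    then obtain u v w where T: "poly T 1 = [:u, v, w:]" by (rule degree_le_2E)
    have "?c p = \<kappa> * w^2" "?c q = 2 * \<kappa> * v * w" "?c r = \<kappa> * (v^2 + 2*u*w)"
         "?c s = 2 * \<kappa> * u * v" "?c t = \<kappa> * u^2"
      using eq unfolding T by (auto simp: algebra_simps power2_eq_square)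
    then show ?thesis unfolding disc27_def invariant_I.simps invariant_J.simps by algebra
  qed
  then show ?thesis unfolding fields disc27_of_int by simp
qed

lemma quartic_thue_binary_form:
  assumes "disc27 F \<noteq> 0" "d \<noteq> 0" shows "quartic_thue (binary_form F) d"
proof -
  have "F \<noteq> (0,0,0,0,0)" using assms(1) disc27_double_root by metis
  moreover have "\<not> const_times_square (of_int_poly2 (binary_form F) :: complex poly poly)"
    using disc27_const_times_square assms(1) by blast
  ultimately show ?thesis
    using assms(2) unfolding quartic_thue_def by (auto intro: homogeneous_binary_form)
qed

section \<open>Reduction of positive definite binary quadratic forms\<close>

definition quad_form :: "int \<Rightarrow> int \<Rightarrow> int \<Rightarrow> int \<Rightarrow> int \<Rightarrow> int" where
  "quad_form A B C u v = A*u^2 + 2*B*u*v + C*v^2"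

lemma quad_form_pos:
  assumes "A > 0" "A*C - B^2 > 0" "u \<noteq> 0 \<or> v \<noteq> 0"
  shows "quad_form A B C u v > 0"
proof -
  have eq: "A * quad_form A B C u v = (A*u + B*v)^2 + (A*C - B^2)*v^2"
    unfolding quad_form_def by algebra
  have "(A*u + B*v)^2 + (A*C - B^2)*v^2 > 0"
  proof (cases "v = 0")
    case True
    then show ?thesis using assms by simp
  next
    case False
    then have "(A*C - B^2)*v^2 > 0" using assms by simp
    then show ?thesis by (simp add: add_nonneg_pos)
  qed
  then show ?thesis using assms(1) eq by (metis zero_less_mult_pos)
qed

lemma round_to_multiple:
  fixes a m :: int assumes "m > 0"
  obtains k where "2 * \<bar>a + k*m\<bar> \<le> m"
proof
  define d r where "d = (2*a + m) div (2*m)" and "r = (2*a + m) mod (2*m)"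
  have "2*a + m = (2*m) * d + r" unfolding d_def r_def by simp
  then have "2*a + m = 2*(d*m) + r" by (simp add: mult_ac)
  moreover have "0 \<le> r" "r < 2*m" unfolding r_def using assms by simp_all
  moreover define z where "z = a + (-d)*m"
  ultimately have "2*z = r - m" by simp
  with \<open>0 \<le> r\<close> \<open>r < 2*m\<close> have "2 * \<bar>z\<bar> \<le> m" by linarith
  then show "2 * \<bar>a + (-d)*m\<bar> \<le> m" unfolding z_def .
qed

text \<open>Among all vectors that are the first column of a unimodular matrix, \<open>(i, k)\<close> is one of minimal value.
  Adding a multiple of it to the second column makes the mixed term \<open>M\<close> at most half that value. The
  second column is itself the first column of a unimodular matrix, with second column \<open>(-i, -k)\<close>, so
  minimality also gives the first inequality. The second one follows from the invariance of the
  determinant, \<open>q(i, k) q(j, l) - M\<^sup>2 = A C - B\<^sup>2\<close>.\<close>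

lemma reduced_basis:
  fixes A B C :: int
  assumes pos: "A > 0" "A*C - B^2 > 0"
  obtains i j k l where "i*l - j*k = 1" "quad_form A B C i k \<le> quad_form A B C j l"
    "3 * (quad_form A B C i k * quad_form A B C j l) \<le> 4 * (A*C - B^2)"
proof -
  let ?q = "quad_form A B C"
  define Pr where "Pr = (\<lambda>(i::int,k::int). \<exists>j l. i*l - j*k = 1)"
  have "Pr (1,0)" unfolding Pr_def by (auto intro: exI[of _ 1])
  then obtain z where z: "Pr z" and least: "\<And>w. Pr w \<Longrightarrow> nat (?q (fst z) (snd z)) \<le> nat (?q (fst w) (snd w))"
    using ex_has_least_nat[of Pr "(1,0)" "\<lambda>w. nat (?q (fst w) (snd w))"] by auto
  obtain i k where zik: "z = (i,k)" by force
  obtain j0 l0 where det0: "i*l0 - j0*k = 1" using z zik unfolding Pr_def by auto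
  have Ppos: "?q i k > 0" using det0 by (intro quad_form_pos pos) auto
  obtain e where e: "2 * \<bar>(A*i*j0 + B*(i*l0 + j0*k) + C*k*l0) + e * ?q i k\<bar> \<le> ?q i k"
    using round_to_multiple[OF Ppos] by blast
  define j l where "j = j0 + e*i" and "l = l0 + e*k"
  define M where "M = A*i*j + B*(i*l + j*k) + C*k*l"
  have M: "2 * \<bar>M\<bar> \<le> ?q i k"
  proof -
    have "M = (A*i*j0 + B*(i*l0 + j0*k) + C*k*l0) + e * ?q i k"
      unfolding M_def j_def l_def quad_form_def by algebra
    then show ?thesis using e by simp
  qed
  have det: "i*l - j*k = 1" using det0 unfolding j_def l_def by (simp add: algebra_simps)
  have "j*(-k) - (-i)*l = 1" using det by (simp add: mult.commute)
  then have "Pr (j,l)" unfolding Pr_def by blast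
  then have le: "?q i k \<le> ?q j l" using least[of "(j,l)"] zik Ppos by auto
  have "?q i k * ?q j l - M^2 = (A*C - B^2) * (i*l - j*k)^2"
    unfolding M_def quad_form_def by algebra
  then have eq: "?q i k * ?q j l = (A*C - B^2) + M^2" using det by simp
  have "(2 * \<bar>M\<bar>)^2 \<le> (?q i k)^2" using M by (intro power_mono) auto
  also have "\<dots> \<le> ?q i k * ?q j l" using le Ppos by (simp add: power2_eq_square mult_left_mono)
  finally have "4 * M^2 \<le> ?q i k * ?q j l" by (simp add: power_mult_distrib)
  moreover have "3 * u \<le> 4 * v" if "4 * w \<le> u" "u = v + w" for u v w :: int
    using that by linarith
  ultimately have "3 * (?q i k * ?q j l) \<le> 4 * (A*C - B^2)" using eq by blast
  with det le show thesis by (rule that)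
qed

section \<open>The covering quartic of an integral point\<close>

text \<open>The expansion of \<open>(t\<^sup>2 - (a x\<^sup>2 + b) z\<^sup>2)\<^sup>2 - a (2 z (x t + y z))\<^sup>2\<close> in which \<open>y\<^sup>2\<close> has been replaced by
  \<open>a x\<^sup>4 + b x\<^sup>2 + c\<close>. Its roots are
  \<open>\<plusminus> \<surd>X \<plusminus> \<surd>(X - e\<^sub>2) \<plusminus> \<surd>(X - e\<^sub>3)\<close> with the product of the signs fixed, where \<open>X = a x\<^sup>2\<close> and
  \<open>0, e\<^sub>2, e\<^sub>3\<close> are the abscissae of the 2-torsion points of \<open>Y\<^sup>2 = X (X\<^sup>2 + b X + a c)\<close>.\<close>

definition covering_quartic :: "int \<Rightarrow> int \<Rightarrow> int \<Rightarrow> int \<Rightarrow> int \<Rightarrow> int quartic" where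
  "covering_quartic a b c x y =
     (1, 0, - (6*a*x^2 + 2*b), - 8*a*x*y, b^2 - 4*a*c - 2*a*b*x^2 - 3*a^2*x^4)"

lemma disc27_covering:
  assumes "y^2 = a*x^4 + b*x^2 + c"
  shows "disc27 (covering_quartic a b c x y) = 110592 * (a*c)^2 * (b^2 - 4*a*c)"
proof -
  have I: "invariant_I (covering_quartic a b c x y) = 16*b^2 - 48*a*c"
    unfolding covering_quartic_def invariant_I.simps by algebra
  have J: "invariant_J (covering_quartic a b c x y) = 576*a*b*c - 128*b^3"
  proof -
    have "invariant_J (covering_quartic a b c x y) = 72 * (- (6*a*x^2 + 2*b)) * (b^2 - 4*a*c - 2*a*b*x^2 - 3*a^2*x^4)
        - 1728 * a^2 * x^2 * y^2 - 2 * (- (6*a*x^2 + 2*b))^3"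
      unfolding covering_quartic_def by (simp add: power_mult_distrib)
    then show ?thesis unfolding assms by algebra
  qed
  show ?thesis unfolding disc27_def I J by algebra
qed

text \<open>The identity that replaces a case distinction on real roots. For large \<open>x\<close> three of the four roots
  \<open>t / z\<close> of the covering quartic lie within \<open>O(1 / x)\<close> of \<open>- y / x\<close>. In the coordinates \<open>x t + y z\<close> and \<open>z\<close>
  this degeneration disappears: up to the factor \<open>x\<^sup>4\<close> the coefficients become those of an explicit
  form that grow only like \<open>x\<^sup>2\<close>.\<close>

lemma covering_in_lattice_coordinates:
  assumes "y^2 = a*x^4 + b*x^2 + c"
    and "covering_quartic a b c x y = (p, q, r, s, t)"
  shows "subst_quartic x y 0 1 (1, -4*y, 4*b*x^2 + 6*c, -4*c*y, c^2) = (x^4*p, x^4*q, x^4*r, x^4*s, x^4*t)"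
proof -
  have e: "p = 1" "q = 0" "r = - (6*a*x^2 + 2*b)" "s = - 8*a*x*y"
      "t = b^2 - 4*a*c - 2*a*b*x^2 - 3*a^2*x^4"
    using assms(2) unfolding covering_quartic_def by simp_all
  show ?thesis using assms(1)
    by (simp add: e, intro conjI; algebra)
qed

section \<open>Reduction of the covering quartic\<close>

fun height_le :: "int \<Rightarrow> int quartic \<Rightarrow> bool" where
  "height_le B (p, q, r, s, t) \<longleftrightarrow> \<bar>p\<bar> \<le> B \<and> \<bar>q\<bar> \<le> B \<and> \<bar>r\<bar> \<le> B \<and> \<bar>s\<bar> \<le> B \<and> \<bar>t\<bar> \<le> B"

text \<open>After expansion the coefficient of \<open>u\<^bsup>4-n\<^esup> v\<^bsup>n\<^esup>\<close> is a sum of monomials, each a coefficient of the original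
  form times \<open>4 - n\<close> entries of the first column and \<open>n\<close> entries of the second. The multiplicities
  add up to 5 times a binomial coefficient, hence to at most 30.\<close>

lemma subst_quartic_bounds:
  fixes i j k l P Q K c0 c1 c2 c3 c4 :: real
  assumes M: "\<bar>i\<bar> \<le> P" "\<bar>k\<bar> \<le> P" "\<bar>j\<bar> \<le> Q" "\<bar>l\<bar> \<le> Q"
    and c: "\<bar>c0\<bar> \<le> K" "\<bar>c1\<bar> \<le> K" "\<bar>c2\<bar> \<le> K" "\<bar>c3\<bar> \<le> K" "\<bar>c4\<bar> \<le> K"
    and F: "subst_quartic i j k l (c0, c1, c2, c3, c4) = (d0, d1, d2, d3, d4)"
  shows "\<bar>d0\<bar> \<le> 30 * K * P^4" "\<bar>d1\<bar> \<le> 30 * K * (P^3 * Q)" "\<bar>d2\<bar> \<le> 30 * K * (P^2 * Q^2)"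
    "\<bar>d3\<bar> \<le> 30 * K * (P * Q^3)" "\<bar>d4\<bar> \<le> 30 * K * Q^4"
proof -
  have nn: "0 \<le> P" "0 \<le> Q" "0 \<le> K" using M c by linarith+
  have mono: "\<bar>c * (i^e1 * k^e2 * (j^e3 * l^e4))\<bar> \<le> K * (P^n * Q^m)"
    if "\<bar>c\<bar> \<le> K" "e1 + e2 = n" "e3 + e4 = m" for c e1 e2 e3 e4 n m
    unfolding abs_mult power_abs power_add that(2,3)[symmetric]
    using that M nn by (intro mult_mono power_mono) auto
  note bound = mono[unfolded abs_le_iff] and c' = c[unfolded abs_le_iff]
  have nonneg: "0 \<le> K * (P^n * Q^m)" for n m using nn by simp
  have "d0 = c0 * (i^4 * k^0 * (j^0 * l^0)) + c1 * (i^3 * k^1 * (j^0 * l^0)) + c2 * (i^2 * k^2 * (j^0 * l^0))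
     + c3 * (i^1 * k^3 * (j^0 * l^0)) + c4 * (i^0 * k^4 * (j^0 * l^0))"
    using F by (auto simp: algebra_simps)
  then have "\<bar>d0\<bar> \<le> 30 * (K * (P^4 * Q^0))" unfolding abs_le_iff
    using nonneg[of 4 0]
      bound[OF c'(1), of 4 0 4 0 0 0, simplified] bound[OF c'(2), of 3 1 4 0 0 0, simplified]
      bound[OF c'(3), of 2 2 4 0 0 0, simplified] bound[OF c'(4), of 1 3 4 0 0 0, simplified]
      bound[OF c'(5), of 0 4 4 0 0 0, simplified]
    by simp
  then show "\<bar>d0\<bar> \<le> 30 * K * P^4" by simp
  have "d1 = 4 * (c0 * (i^3 * k^0 * (j^1 * l^0))) + 3 * (c1 * (i^2 * k^1 * (j^1 * l^0))) + c1 * (i^3 * k^0 * (j^0 * l^1))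
     + 2 * (c2 * (i^1 * k^2 * (j^1 * l^0))) + 2 * (c2 * (i^2 * k^1 * (j^0 * l^1))) + c3 * (i^0 * k^3 * (j^1 * l^0))
     + 3 * (c3 * (i^1 * k^2 * (j^0 * l^1))) + 4 * (c4 * (i^0 * k^3 * (j^0 * l^1)))"
    using F by (auto simp: algebra_simps)
  then have "\<bar>d1\<bar> \<le> 30 * (K * (P^3 * Q^1))" unfolding abs_le_iff
    using nonneg[of 3 1]
      bound[OF c'(1), of 3 0 3 1 0 1, simplified] bound[OF c'(2), of 2 1 3 1 0 1, simplified]
      bound[OF c'(2), of 3 0 3 0 1 1, simplified] bound[OF c'(3), of 1 2 3 1 0 1, simplified]
      bound[OF c'(3), of 2 1 3 0 1 1, simplified] bound[OF c'(4), of 0 3 3 1 0 1, simplified]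
      bound[OF c'(4), of 1 2 3 0 1 1, simplified] bound[OF c'(5), of 0 3 3 0 1 1, simplified]
    by simp
  then show "\<bar>d1\<bar> \<le> 30 * K * (P^3 * Q)" by simp
  have "d2 = 6 * (c0 * (i^2 * k^0 * (j^2 * l^0))) + 3 * (c1 * (i^1 * k^1 * (j^2 * l^0))) + 3 * (c1 * (i^2 * k^0 * (j^1 * l^1)))
     + c2 * (i^0 * k^2 * (j^2 * l^0)) + 4 * (c2 * (i^1 * k^1 * (j^1 * l^1))) + c2 * (i^2 * k^0 * (j^0 * l^2))
     + 3 * (c3 * (i^0 * k^2 * (j^1 * l^1))) + 3 * (c3 * (i^1 * k^1 * (j^0 * l^2))) + 6 * (c4 * (i^0 * k^2 * (j^0 * l^2)))"
    using F by (auto simp: algebra_simps)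
  then have "\<bar>d2\<bar> \<le> 30 * (K * (P^2 * Q^2))" unfolding abs_le_iff
    using nonneg[of 2 2]
      bound[OF c'(1), of 2 0 2 2 0 2, simplified] bound[OF c'(2), of 1 1 2 2 0 2, simplified]
      bound[OF c'(2), of 2 0 2 1 1 2, simplified] bound[OF c'(3), of 0 2 2 2 0 2, simplified]
      bound[OF c'(3), of 1 1 2 1 1 2, simplified] bound[OF c'(3), of 2 0 2 0 2 2, simplified]
      bound[OF c'(4), of 0 2 2 1 1 2, simplified] bound[OF c'(4), of 1 1 2 0 2 2, simplified]
      bound[OF c'(5), of 0 2 2 0 2 2, simplified]
    by simp
  then show "\<bar>d2\<bar> \<le> 30 * K * (P^2 * Q^2)" by simp
  have "d3 = 4 * (c0 * (i^1 * k^0 * (j^3 * l^0))) + 3 * (c1 * (i^1 * k^0 * (j^2 * l^1))) + c1 * (i^0 * k^1 * (j^3 * l^0))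
     + 2 * (c2 * (i^1 * k^0 * (j^1 * l^2))) + 2 * (c2 * (i^0 * k^1 * (j^2 * l^1))) + c3 * (i^1 * k^0 * (j^0 * l^3))
     + 3 * (c3 * (i^0 * k^1 * (j^1 * l^2))) + 4 * (c4 * (i^0 * k^1 * (j^0 * l^3)))"
    using F by (auto simp: algebra_simps)
  then have "\<bar>d3\<bar> \<le> 30 * (K * (P^1 * Q^3))" unfolding abs_le_iff
    using nonneg[of 1 3]
      bound[OF c'(1), of 1 0 1 3 0 3, simplified] bound[OF c'(2), of 1 0 1 2 1 3, simplified]
      bound[OF c'(2), of 0 1 1 3 0 3, simplified] bound[OF c'(3), of 1 0 1 1 2 3, simplified]
      bound[OF c'(3), of 0 1 1 2 1 3, simplified] bound[OF c'(4), of 1 0 1 0 3 3, simplified]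
      bound[OF c'(4), of 0 1 1 1 2 3, simplified] bound[OF c'(5), of 0 1 1 0 3 3, simplified]
    by simp
  then show "\<bar>d3\<bar> \<le> 30 * K * (P * Q^3)" by simp
  have "d4 = c0 * (i^0 * k^0 * (j^4 * l^0)) + c1 * (i^0 * k^0 * (j^3 * l^1)) + c2 * (i^0 * k^0 * (j^2 * l^2))
     + c3 * (i^0 * k^0 * (j^1 * l^3)) + c4 * (i^0 * k^0 * (j^0 * l^4))"
    using F by (auto simp: algebra_simps)
  then have "\<bar>d4\<bar> \<le> 30 * (K * (P^0 * Q^4))" unfolding abs_le_iff
    using nonneg[of 0 4]
      bound[OF c'(1), of 0 0 0 4 0 4, simplified] bound[OF c'(2), of 0 0 0 3 1 4, simplified]
      bound[OF c'(3), of 0 0 0 2 2 4, simplified] bound[OF c'(4), of 0 0 0 1 3 4, simplified]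
      bound[OF c'(5), of 0 0 0 0 4 4, simplified]
    by simp
  then show "\<bar>d4\<bar> \<le> 30 * K * Q^4" by simp
qed

lemma abs_le_square_int: "\<bar>x\<bar> \<le> x^2" for x :: int
proof (cases "x = 0")
  case False
  then have "\<bar>x\<bar> \<le> \<bar>x\<bar>^2" by (intro self_le_power) auto
  then show ?thesis by simp
qed simp

text \<open>A crude bound: \<open>\<surd>(3 h) x\<^sup>2\<close> would do, and \<open>3 h x\<^sup>2\<close> avoids the root.\<close>

lemma abs_y_le:
  fixes a b c x y h :: int
  assumes "y^2 = a*x^4 + b*x^2 + c" "x \<noteq> 0"
    and h: "1 \<le> h" "\<bar>a\<bar> \<le> h" "\<bar>b\<bar> \<le> h" "\<bar>c\<bar> \<le> h"
  shows "\<bar>y\<bar> \<le> 3*h*x^2"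
proof -
  have x1: "1 \<le> x^2" using assms(2) by (smt (verit) zero_less_power2)
  have x4: "x^4 = x^2*x^2" by algebra
  have x24: "x^2 \<le> x^4" using mult_left_mono[OF x1, of "x^2"] unfolding x4 by simp
  have "a*x^4 \<le> h*x^4" using h by (intro mult_right_mono) auto
  moreover have "b*x^2 \<le> h*x^2" using h by (intro mult_right_mono) auto
  moreover have h0: "0 \<le> h" using h(1) by linarith
  moreover have "h*x^2 \<le> h*x^4" by (rule mult_left_mono[OF x24 h0])
  moreover have "h*1 \<le> h*x^4" by (rule mult_left_mono[OF order_trans[OF x1 x24] h0])
  ultimately have "y^2 \<le> 3*h*x^4" using assms(1) h(4) by linarith
  also have "\<dots> \<le> (3*h)*(3*h)*x^4"
  proof (intro mult_right_mono)
    show "3*h \<le> (3*h)*(3*h)" using h(1) by (simp add: mult_le_cancel_left1)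
  qed auto
  also have "\<dots> = (3*h*x^2)^2" by algebra
  finally have "\<bar>y\<bar>^2 \<le> (3*h*x^2)^2" by simp
  then show ?thesis by (rule power2_le_imp_le) (use h(1) in simp)
qed

text \<open>The heart of the reduction. The reals \<open>P \<le> Q\<close> are the lengths of the basis vectors and \<open>d0, d1\<close> the
  first two coefficients of the reduced form. One of them has absolute value at least 1, because it is
  a non-zero integer in the application, and the upper bounds for \<open>d0\<close> and \<open>d1\<close> then force
  \<open>P\<^sup>2 \<ge> X / (2 k)\<close>; since \<open>P Q\<close> is at most a multiple of \<open>X\<close>, this bounds \<open>Q\<close> from above.\<close>

lemma longer_basis_vector_bound:
  fixes P Q X k d0 d1 :: real
  assumes X: "X > 0" and PQ: "0 \<le> P" "P \<le> Q" "3 * (P^2 * Q^2) \<le> 4 * X^2" and k: "k \<ge> 1"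
    and d: "X^2 * \<bar>d0\<bar> \<le> k * P^4" "X^2 * \<bar>d1\<bar> \<le> k * (P^3 * Q)" "1 \<le> \<bar>d0\<bar> \<or> 1 \<le> \<bar>d1\<bar>"
  shows "Q^2 \<le> 3 * k * X"
proof -
  have "0 \<le> P^2*Q^2" by simp
  then have "P^2*Q^2 \<le> 4*X^2" using PQ(3) by linarith
  then have "(P*Q)^2 \<le> (2*X)^2" by (simp add: power_mult_distrib)
  then have PQ2: "P*Q \<le> 2*X" using X by (intro power2_le_imp_le[of "P*Q" "2*X"]) auto
  have "X \<le> 2*k*P^2"
    using d(3)
  proof
    assume "1 \<le> \<bar>d0\<bar>"
    then have "X^2 * 1 \<le> X^2 * \<bar>d0\<bar>" by (intro mult_left_mono) auto
    also have "\<dots> \<le> k * P^4" by (rule d(1))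
    also have "\<dots> \<le> (2*k)^2 * P^4"
    proof (intro mult_right_mono)
      have "k * 1 \<le> k * (4 * k)" using k by (intro mult_left_mono) auto
      then show "k \<le> (2*k)^2" by (simp add: power2_eq_square)
    qed auto
    also have "\<dots> = (2*k*P^2)^2" by algebra
    finally show ?thesis using k by (intro power2_le_imp_le[of X]) auto
  next
    assume "1 \<le> \<bar>d1\<bar>"
    then have "X^2 * 1 \<le> X^2 * \<bar>d1\<bar>" by (intro mult_left_mono) auto
    also have "\<dots> \<le> k * (P^3 * Q)" by (rule d(2))
    also have "\<dots> = (k * P^2) * (P*Q)" by algebra
    also have "\<dots> \<le> (k * P^2) * (2*X)" using PQ2 k by (intro mult_left_mono) auto
    finally have "X * X \<le> (2*k*P^2) * X" by (simp add: power2_eq_square algebra_simps)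
    then show ?thesis using X by simp
  qed
  then have "X * Q^2 \<le> (2*k*P^2) * Q^2" by (intro mult_right_mono) auto
  also have "\<dots> = k * (2 * (P^2 * Q^2))" by simp
  also have "\<dots> \<le> k * (3 * X^2)"
  proof (rule mult_left_mono)
    show "2 * (P^2 * Q^2) \<le> 3 * X^2" using PQ(3) zero_le_power2[of X] by linarith
  qed (use k in simp)
  also have "\<dots> = X * (3*k*X)" by (simp add: power2_eq_square)
  finally show ?thesis using X by simp
qed

text \<open>For \<open>x \<noteq> 0\<close> the form \<open>(x u + y v)\<^sup>2 + v\<^sup>2\<close> of determinant \<open>x\<^sup>2\<close> is reduced, and the basis found
  is used for the covering quartic. Non-vanishing of the discriminant excludes that the first two
  coefficients vanish together, as \<open>longer_basis_vector_bound\<close> requires.\<close>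

lemma covering_equivalent_to_small:
  fixes a b c x y h :: int
  assumes curve: "y^2 = a*x^4 + b*x^2 + c" and nondeg: "a*c*(b^2 - 4*a*c) \<noteq> 0"
    and h: "1 \<le> h" "\<bar>a\<bar> \<le> h" "\<bar>b\<bar> \<le> h" "\<bar>c\<bar> \<le> h"
  obtains i j k l where "i*l - j*k = 1"
    "height_le (9 * (360*h^2)^3) (subst_quartic i j k l (covering_quartic a b c x y))"
proof (cases "x = 0")
  case True
  \<comment> \<open>Here the covering quartic is itself small and the identity substitution suffices.\<close>
  have small: "B \<le> 9 * (360*h^2)^3" if "B \<le> 360*h^2" for B
  proof -
    define z where "z = 360 * h^2"
    have "1 \<le> z" unfolding z_def using one_le_power[OF h(1), of 2] by linarith
    then have "z \<le> z^3" by (intro self_le_power) auto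
    then show ?thesis using that \<open>1 \<le> z\<close> unfolding z_def[symmetric] by linarith
  qed
  have hh: "h \<le> h^2" "1 \<le> h^2" using h(1) by (simp_all add: self_le_power one_le_power)
  have "\<bar>b\<bar>^2 \<le> h^2" using h by (intro power_mono) auto
  moreover have "\<bar>a\<bar>*\<bar>c\<bar> \<le> h*h" using h by (intro mult_mono) auto
  ultimately have "\<bar>b^2\<bar> \<le> h^2" "\<bar>a*c\<bar> \<le> h^2" by (simp_all add: abs_mult power2_eq_square)
  then have "\<bar>b^2 - 4*(a*c)\<bar> \<le> 360*h^2" using hh by linarith
  then have "\<bar>b^2 - 4*a*c\<bar> \<le> 360*h^2" by (simp add: mult.assoc)
  moreover have "\<bar>1\<bar> \<le> 360*h^2" "\<bar>0\<bar> \<le> 360*h^2" "\<bar>2*b\<bar> \<le> 360*h^2" using hh h by linarith+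
  moreover have "subst_quartic 1 0 0 1 (covering_quartic a b c x y) = (1, 0, - (2*b), 0, b^2 - 4*a*c)"
    unfolding covering_quartic_def using True by simp
  ultimately have "height_le (9 * (360*h^2)^3) (subst_quartic 1 0 0 1 (covering_quartic a b c x y))"
    by (simp only: height_le.simps small abs_minus_cancel simp_thms)
  then show ?thesis by (intro that) auto
next
  case False
  then have x1: "1 \<le> x^2" by (smt (verit) zero_less_power2)
  have det_eq: "x^2*(y^2+1) - (x*y)^2 = x^2" by algebra
  have pos: "0 < x^2" "0 < x^2*(y^2+1) - (x*y)^2" unfolding det_eq using x1 by linarith+
  obtain i j k l where det: "i*l - j*k = 1"
    and le: "quad_form (x^2) (x*y) (y^2+1) i k \<le> quad_form (x^2) (x*y) (y^2+1) j l"
    and prod: "3 * (quad_form (x^2) (x*y) (y^2+1) i k * quad_form (x^2) (x*y) (y^2+1) j l) \<le> 4*(x^2*(y^2+1) - (x*y)^2)"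
    by (rule reduced_basis[OF pos])
  have quad_form: "quad_form (x^2) (x*y) (y^2+1) u v = (x*u + y*v)^2 + v^2" for u v
    unfolding quad_form_def by algebra
  obtain p q r s t where f: "covering_quartic a b c x y = (p, q, r, s, t)" by (rule prod_cases5)
  obtain d0 d1 d2 d3 d4 where F: "subst_quartic i j k l (covering_quartic a b c x y) = (d0, d1, d2, d3, d4)"
    by (rule prod_cases5)
  have "subst_quartic (x*i + y*k) (x*j + y*l) k l (1, -4*y, 4*b*x^2 + 6*c, -4*c*y, c^2)
     = subst_quartic i j k l (subst_quartic x y 0 1 (1, -4*y, 4*b*x^2 + 6*c, -4*c*y, c^2))"
    by (simp only: subst_quartic_comp) simp
  also have "\<dots> = (x^4*d0, x^4*d1, x^4*d2, x^4*d3, x^4*d4)"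
    unfolding covering_in_lattice_coordinates[OF curve f] using subst_quartic_scale[OF F f] .
  finally have G: "subst_quartic (x*i + y*k) (x*j + y*l) k l (1, -4*y, 4*b*x^2 + 6*c, -4*c*y, c^2)
      = (x^4*d0, x^4*d1, x^4*d2, x^4*d3, x^4*d4)" .
  \<comment> \<open>The lengths of \<open>(i, k)\<close> and \<open>(j, l)\<close> with respect to \<open>(x u + y v)\<^sup>2 + v\<^sup>2\<close>.\<close>
  define P where "P = sqrt (of_int ((x*i + y*k)^2 + k^2))"
  define Q where "Q = sqrt (of_int ((x*j + y*l)^2 + l^2))"
  define K where "K = real_of_int (12*h^2*x^2)"
  define X where "X = \<bar>real_of_int x\<bar>"
  have P: "\<bar>real_of_int (x*i + y*k)\<bar> \<le> P" "\<bar>real_of_int k\<bar> \<le> P" "0 \<le> P"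
    and Q: "\<bar>real_of_int (x*j + y*l)\<bar> \<le> Q" "\<bar>real_of_int l\<bar> \<le> Q" "0 \<le> Q"
    unfolding P_def Q_def by (auto intro!: real_le_rsqrt)
  have PQ: "P \<le> Q" using le unfolding P_def Q_def quad_form by (simp only: real_sqrt_le_iff of_int_le_iff)
  have P2: "P^2 = of_int ((x*i + y*k)^2 + k^2)" and Q2: "Q^2 = of_int ((x*j + y*l)^2 + l^2)"
    unfolding P_def Q_def by (simp_all del: of_int_add of_int_mult of_int_power)
  have "3 * (((x*i + y*k)^2 + k^2) * ((x*j + y*l)^2 + l^2)) \<le> 4*x^2"
    using prod unfolding quad_form det_eq .
  then have "3 * (P^2 * Q^2) \<le> real_of_int (4*x^2)"
    unfolding P2 Q2 by (metis of_int_le_iff of_int_mult of_int_numeral)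
  then have PQX: "3 * (P^2 * Q^2) \<le> 4 * X^2" unfolding X_def by simp
  have coefs: "\<bar>1\<bar> \<le> 12*h^2*x^2" "\<bar>-4*y\<bar> \<le> 12*h^2*x^2" "\<bar>4*b*x^2 + 6*c\<bar> \<le> 12*h^2*x^2"
     "\<bar>-4*c*y\<bar> \<le> 12*h^2*x^2" "\<bar>c^2\<bar> \<le> 12*h^2*x^2"
  proof -
    have hh: "h \<le> h^2" "1 \<le> h^2" using h(1) by (simp_all add: self_le_power one_le_power)
    have 1: "h^2 * 1 \<le> h^2*x^2" using x1 by (intro mult_left_mono) auto
    have 2: "h * x^2 \<le> h^2 * x^2" using hh by (intro mult_right_mono) auto
    have y: "\<bar>y\<bar> \<le> 3*h*x^2" using abs_y_le[OF curve False h] .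
    show "\<bar>1\<bar> \<le> 12*h^2*x^2" "\<bar>-4*y\<bar> \<le> 12*h^2*x^2" using hh 1 2 y by linarith+
    have "\<bar>b*x^2\<bar> \<le> h*x^2" unfolding abs_mult using h by (intro mult_mono) auto
    then show "\<bar>4*b*x^2 + 6*c\<bar> \<le> 12*h^2*x^2" using 1 2 hh h by linarith
    have "\<bar>c*y\<bar> \<le> h*(3*h*x^2)" unfolding abs_mult using h y by (intro mult_mono) auto
    then show "\<bar>-4*c*y\<bar> \<le> 12*h^2*x^2" by (simp add: power2_eq_square algebra_simps)
    have "\<bar>c\<bar>^2 \<le> h^2" using h by (intro power_mono) auto
    then have "c^2 \<le> h^2" by simp
    then show "\<bar>c^2\<bar> \<le> 12*h^2*x^2" using 1 zero_le_power2[of c] zero_le_power2[of h] by linarith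
  qed
  then have coefsK: "\<bar>real_of_int 1\<bar> \<le> K" "\<bar>real_of_int (-4*y)\<bar> \<le> K"
     "\<bar>real_of_int (4*b*x^2 + 6*c)\<bar> \<le> K" "\<bar>real_of_int (-4*c*y)\<bar> \<le> K" "\<bar>real_of_int (c^2)\<bar> \<le> K"
    unfolding K_def by (simp_all only: of_int_le_iff flip: of_int_abs)
  note bd = subst_quartic_bounds[OF P(1,2) Q(1,2) coefsK subst_quartic_of_int[OF G]]
  \<comment> \<open>\<open>360 = 30 \<cdot> 12\<close>, from \<open>subst_quartic_bounds\<close> and the bound \<open>12 h\<^sup>2 x\<^sup>2\<close> for the coefficients\<close>
  define \<kappa> where "\<kappa> = real_of_int (360 * h^2)"
  have K\<kappa>: "30 * K = X^2 * \<kappa>" unfolding K_def \<kappa>_def X_def by simp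
  have X0: "X > 0" unfolding X_def using False by simp
  have h2: "1 \<le> h^2" using h(1) by (simp add: one_le_power)
  then have \<kappa>1: "1 \<le> \<kappa>" unfolding \<kappa>_def by linarith
  have red: "X^2 * \<bar>real_of_int d\<bar> \<le> \<kappa> * Y" if "\<bar>real_of_int (x^4*d)\<bar> \<le> 30 * K * Y" for d Y
  proof -
    have "\<bar>real_of_int (x^4*d)\<bar> = X^4 * \<bar>real_of_int d\<bar>"
      unfolding X_def by (simp add: abs_mult)
    also have "\<dots> = X^2 * (X^2 * \<bar>real_of_int d\<bar>)" by algebra
    finally have "X^2 * (X^2 * \<bar>real_of_int d\<bar>) \<le> X^2 * (\<kappa> * Y)"
      using that unfolding K\<kappa> by (simp only: mult.assoc)
    then show ?thesis by (rule mult_left_le_imp_le) (use X0 in simp)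
  qed
  note bd' = bd[THEN red]
  have "disc27 (d0, d1, d2, d3, d4) \<noteq> 0"
    unfolding F[symmetric] disc27_subst[OF det] disc27_covering[OF curve]
    using nondeg by (simp only: mult_eq_0_iff power_eq_0_iff zero_neq_numeral simp_thms de_Morgan_disj)
  then have "d0 \<noteq> 0 \<or> d1 \<noteq> 0" using disc27_double_root by metis
  then have "1 \<le> \<bar>real_of_int d0\<bar> \<or> 1 \<le> \<bar>real_of_int d1\<bar>" by linarith
  from longer_basis_vector_bound[OF X0 P(3) PQ PQX \<kappa>1 bd'(1,2) this]
  have QX: "Q^2 \<le> 3 * \<kappa> * X" .
  have Q4: "Q^4 \<le> 9 * \<kappa>^2 * X^2"
  proof -
    have "(Q^2)^2 \<le> (3 * \<kappa> * X)^2" using QX by (intro power_mono) auto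
    then show ?thesis by (simp add: power_mult_distrib flip: power_mult)
  qed
  have fin: "\<bar>d\<bar> \<le> 9 * (360*h^2)^3" if "X^2 * \<bar>real_of_int d\<bar> \<le> \<kappa> * Y" "Y \<le> Q^4" for d Y
  proof -
    have "\<kappa> * Y \<le> \<kappa> * (9 * \<kappa>^2 * X^2)" using that(2) Q4 \<kappa>1 by (intro mult_left_mono) auto
    also have "\<dots> = X^2 * (9 * \<kappa>^3)" by algebra
    finally have "X^2 * \<bar>real_of_int d\<bar> \<le> X^2 * (9 * \<kappa>^3)" using that(1) by linarith
    then have "\<bar>real_of_int d\<bar> \<le> 9 * \<kappa>^3" using X0 by simp
    then have "real_of_int \<bar>d\<bar> \<le> real_of_int (9 * (360*h^2)^3)" unfolding \<kappa>_def by simp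
    then show ?thesis by (simp only: of_int_le_iff)
  qed
  have Y: "P^4 \<le> Q^4" "P^3 * Q \<le> Q^4" "P^2 * Q^2 \<le> Q^4" "P * Q^3 \<le> Q^4"
  proof -
    show "P^4 \<le> Q^4" using PQ P(3) by (intro power_mono)
    have e: "Q^4 = Q^3 * Q" "Q^4 = Q^2 * Q^2" "Q^4 = Q * Q^3" by algebra+
    show "P^3 * Q \<le> Q^4" unfolding e(1) using PQ P(3) Q(3) by (intro mult_right_mono power_mono)
    show "P^2 * Q^2 \<le> Q^4" unfolding e(2) using PQ P(3) by (intro mult_right_mono power_mono) auto
    show "P * Q^3 \<le> Q^4" unfolding e(3) using PQ Q(3) by (intro mult_right_mono) auto
  qed
  have "height_le (9 * (360*h^2)^3) (subst_quartic i j k l (covering_quartic a b c x y))"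
    unfolding F height_le.simps
    by (intro conjI fin[OF bd'(1) Y(1)] fin[OF bd'(2) Y(2)] fin[OF bd'(3) Y(3)]
      fin[OF bd'(4) Y(4)] fin[OF bd'(5) order.refl])
  then show ?thesis using det by (rule that[rotated])
qed

section \<open>Recovering the integral point\<close>

text \<open>Since \<open>(l, - k)\<close> is the inverse image of \<open>(1, 0)\<close> under the substitution, covariance of the Hessian
  equates its value for the transformed form at \<open>(l, - k)\<close> with its value for the covering quartic at
  \<open>(1, 0)\<close>, which is \<open>48 a x\<^sup>2 + 16 b\<close>. The former is a polynomial in quantities bounded by \<open>w\<close>.\<close>

lemma solution_size:
  fixes a b c x y w i j k l :: int
  assumes curve: "y^2 = a*x^4 + b*x^2 + c" and a0: "a \<noteq> 0" and det: "i*l - j*k = 1"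
    and F: "height_le w (subst_quartic i j k l (covering_quartic a b c x y))"
    and w: "\<bar>a\<bar> \<le> w" "\<bar>b\<bar> \<le> w" "\<bar>c\<bar> \<le> w" "\<bar>l\<bar> \<le> w" "\<bar>k\<bar> \<le> w"
  shows "\<bar>x\<bar> \<le> 456 * w^7" "\<bar>y\<bar> \<le> 456 * w^7"
proof -
  have w1: "1 \<le> w" using a0 w(1) by linarith
  obtain p q r s t where F': "subst_quartic i j k l (covering_quartic a b c x y) = (p, q, r, s, t)" by (rule prod_cases5)
  have "eval_quartic (hessian (p, q, r, s, t)) l (-k) =
      eval_quartic (hessian (covering_quartic a b c x y)) (i*l + j*(-k)) (k*l + l*(-k))"
    unfolding F'[symmetric] hessian_subst det by simp
  also have "\<dots> = 8*(6*a*x^2 + 2*b)" using det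
    by (simp add: covering_quartic_def algebra_simps)
  finally have H: "48*(a*x^2) + 16*b = eval_quartic (hessian (p, q, r, s, t)) l (-k)" by simp
  have c: "\<bar>p\<bar> \<le> w" "\<bar>q\<bar> \<le> w" "\<bar>r\<bar> \<le> w" "\<bar>s\<bar> \<le> w" "\<bar>t\<bar> \<le> w" using F unfolding F' by simp_all
  have mono: "\<bar>(u*v)*(l^m * k^n)\<bar> \<le> w^6" if "\<bar>u\<bar> \<le> w" "\<bar>v\<bar> \<le> w" "m + n = 4" for u v m n
  proof -
    have "\<bar>(u*v)*(l^m * k^n)\<bar> \<le> (w*w)*(w^m * w^n)" unfolding abs_mult power_abs
      using that(1,2) w(4,5) w1 by (intro mult_mono power_mono) auto
    also have "\<dots> = w^(2+(m+n))" by (simp only: power_add power2_eq_square)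
    finally show ?thesis using that(3) by simp
  qed
  have "eval_quartic (hessian (p, q, r, s, t)) l (-k) =
     3*((q*q)*(l^4*k^0)) - 8*((p*r)*(l^4*k^0)) - 4*((q*r)*(l^3*k^1)) + 24*((p*s)*(l^3*k^1))
     + 4*((r*r)*(l^2*k^2)) - 48*((p*t)*(l^2*k^2)) - 6*((q*s)*(l^2*k^2))
     - 4*((r*s)*(l^1*k^3)) + 24*((q*t)*(l^1*k^3)) + 3*((s*s)*(l^0*k^4)) - 8*((r*t)*(l^0*k^4))"
    unfolding hessian.simps eval_quartic.simps by algebra
  \<comment> \<open>\<open>136\<close> is the sum of the absolute values of the numerical coefficients above\<close>
  moreover have e: "4 + 0 = (4::nat)" "3 + 1 = (4::nat)" "2 + 2 = (4::nat)" "1 + 3 = (4::nat)"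
    "0 + 4 = (4::nat)" by simp_all
  note mono[OF c(2) c(2) e(1)] mono[OF c(1) c(3) e(1)] mono[OF c(2) c(3) e(2)]
    mono[OF c(1) c(4) e(2)] mono[OF c(3) c(3) e(3)] mono[OF c(1) c(5) e(3)]
    mono[OF c(2) c(4) e(3)] mono[OF c(3) c(4) e(4)] mono[OF c(2) c(5) e(4)]
    mono[OF c(4) c(4) e(5)] mono[OF c(3) c(5) e(5)]
  note this[unfolded abs_le_iff]
  ultimately have "\<bar>eval_quartic (hessian (p, q, r, s, t)) l (-k)\<bar> \<le> 136 * w^6"
    unfolding abs_le_iff by linarith
  moreover have "w \<le> w^6" using w1 by (intro self_le_power) auto
  ultimately have ax: "\<bar>a*x^2\<bar> \<le> 152 * w^6" using H w(2) by linarith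
  have "1 * x^2 \<le> \<bar>a\<bar> * x^2" using a0 by (intro mult_right_mono) auto
  then have x2: "x^2 \<le> 152 * w^6" using ax by (simp add: abs_mult)
  have w67: "w^6 \<le> w^7" "w \<le> w^7" using w1 by (auto intro: power_increasing self_le_power)
  have "\<bar>x\<bar> \<le> x^2" by (rule abs_le_square_int)
  then show "\<bar>x\<bar> \<le> 456 * w^7" using x2 w67 w1 by linarith
  show "\<bar>y\<bar> \<le> 456 * w^7"
  proof (cases "x = 0")
    case True
    then have "y^2 = c" using curve by simp
    moreover have "\<bar>y\<bar> \<le> y^2" by (rule abs_le_square_int)
    ultimately show ?thesis using w w67 by linarith
  next
    case False
    have "\<bar>y\<bar> \<le> 3*w*x^2" using abs_y_le[OF curve False w1 w(1-3)] .
    also have "\<dots> \<le> 3*w*(152*w^6)" using x2 w1 by (intro mult_left_mono) auto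
    also have "\<dots> = 456 * w^7" by algebra
    finally show ?thesis .
  qed
qed

section \<open>Closure properties of the recursive functions\<close>

text \<open>The predicate \<^const>\<open>recursive\<close> concerns a function on all lists, but only its values on lists of
  length \<open>n\<close> matter. Forgetting the other values makes the predicate stable under rewriting and gives
  it closure rules that can be applied mechanically to expressions.\<close>

definition rec_on :: "nat \<Rightarrow> (nat list \<Rightarrow> nat) \<Rightarrow> bool" where
  "rec_on n f \<longleftrightarrow> (\<exists>F. recursive n F \<and> (\<forall>xs. length xs = n \<longrightarrow> F xs = f xs))"

lemma rec_onI: "recursive n F \<Longrightarrow> (\<And>xs. length xs = n \<Longrightarrow> F xs = f xs) \<Longrightarrow> rec_on n f"
  unfolding rec_on_def by blast

lemma rec_on_proj: "i < n \<Longrightarrow> rec_on n (\<lambda>xs. xs ! i)"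
  by (rule rec_onI[OF recursive.proj]) auto

lemma rec_on_comp:
  assumes f: "rec_on (length gs) f" and gs: "\<And>g. g \<in> set gs \<Longrightarrow> rec_on n g"
  shows "rec_on n (\<lambda>xs. f (map (\<lambda>g. g xs) gs))"
proof -
  obtain F where F: "recursive (length gs) F" "\<And>xs. length xs = length gs \<Longrightarrow> F xs = f xs"
    using f unfolding rec_on_def by blast
  obtain G where G: "\<And>g. g \<in> set gs \<Longrightarrow> recursive n (G g) \<and> (\<forall>xs. length xs = n \<longrightarrow> G g xs = g xs)"
    using gs unfolding rec_on_def by metis
  have "recursive n (\<lambda>xs. F (map (\<lambda>g. g xs) (map G gs)))"
    by (rule recursive.comp) (use F(1) G in auto)
  then show ?thesis
  proof (rule rec_onI)
    fix xs :: "nat list" assume "length xs = n"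
    then have "map (\<lambda>g. g xs) (map G gs) = map (\<lambda>g. g xs) gs" using G by auto
    then show "F (map (\<lambda>g. g xs) (map G gs)) = f (map (\<lambda>g. g xs) gs)"
      by (simp only:) (simp add: F(2))
  qed
qed

lemma rec_on_comp1:
  assumes "rec_on 1 (\<lambda>ys. f (ys ! 0))" "rec_on n g" shows "rec_on n (\<lambda>xs. f (g xs))"
  using rec_on_comp[of "[g]" "\<lambda>ys. f (ys ! 0)" n] assms by simp

lemma rec_on_comp2:
  assumes "rec_on 2 (\<lambda>ys. f (ys ! 0) (ys ! 1))" "rec_on n g" "rec_on n h"
  shows "rec_on n (\<lambda>xs. f (g xs) (h xs))"
  using rec_on_comp[of "[g, h]" "\<lambda>ys. f (ys ! 0) (ys ! 1)" n] assms
  by (auto simp: numeral_2_eq_2)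

lemma rec_on_Suc: "rec_on n f \<Longrightarrow> rec_on n (\<lambda>xs. Suc (f xs))"
  by (rule rec_on_comp1[of Suc, OF rec_onI[OF recursive.succ]]) auto

lemma rec_on_const: "rec_on n (\<lambda>xs. c)"
proof (induction c)
  case 0
  show ?case by (rule rec_onI[OF recursive.zero]) simp
qed (rule rec_on_Suc)

lemma rec_on_rec_nat:
  assumes t: "rec_on n t" and b: "rec_on n b" and s: "rec_on (n + 2) s"
  shows "rec_on n (\<lambda>xs. rec_nat (b xs) (\<lambda>k r. s (k # r # xs)) (t xs))"
proof -
  obtain B where B: "recursive n B" "\<And>xs. length xs = n \<Longrightarrow> B xs = b xs"
    using b unfolding rec_on_def by blast
  obtain S where S: "recursive (n + 2) S" "\<And>xs. length xs = n + 2 \<Longrightarrow> S xs = s xs"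
    using s unfolding rec_on_def by blast
  let ?f = "\<lambda>ys. rec_nat (b (tl ys)) (\<lambda>k r. s (k # r # tl ys)) (hd ys)"
  have f: "rec_on (Suc n) ?f"
  proof (rule rec_onI[OF recursive.prim_rec[OF B(1) S(1)]])
    fix ys :: "nat list" assume l: "length ys = Suc n"
    have "rec_nat (B (tl ys)) (\<lambda>k r. S (k # r # tl ys)) m = rec_nat (b (tl ys)) (\<lambda>k r. s (k # r # tl ys)) m" for m
      using l by (induction m) (simp_all add: B(2) S(2))
    then show "rec_nat (B (tl ys)) (\<lambda>k r. S (k # r # tl ys)) (hd ys) = ?f ys" .
  qed
  let ?gs = "t # map (\<lambda>i xs. xs ! i) [0..<n]"
  have "rec_on n (\<lambda>xs. ?f (map (\<lambda>g. g xs) ?gs))"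
    by (rule rec_on_comp) (use f t in \<open>auto intro: rec_on_proj\<close>)
  then obtain F where F: "recursive n F" "\<And>xs. length xs = n \<Longrightarrow> F xs = ?f (map (\<lambda>g. g xs) ?gs)"
    unfolding rec_on_def by blast
  show ?thesis
  proof (rule rec_onI[OF F(1)])
    fix xs :: "nat list" assume "length xs = n"
    then have "map (\<lambda>g. g xs) (map (\<lambda>i xs. xs ! i) [0..<n]) = xs"
      by (simp add: comp_def map_nth flip: \<open>length xs = n\<close>)
    then show "F xs = rec_nat (b xs) (\<lambda>k r. s (k # r # xs)) (t xs)"
      using F(2) \<open>length xs = n\<close> by simp
  qed
qed

lemma rec_on_LEAST:
  assumes f: "rec_on (Suc n) f" and ex: "\<And>xs. length xs = n \<Longrightarrow> \<exists>k. f (k # xs) = 0"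
  shows "rec_on n (\<lambda>xs. LEAST k. f (k # xs) = 0)"
proof -
  obtain F where F: "recursive (Suc n) F" "\<And>xs. length xs = Suc n \<Longrightarrow> F xs = f xs"
    using f unfolding rec_on_def by blast
  show ?thesis
    by (rule rec_onI[OF recursive.minim[OF F(1)]]) (use F(2) ex in auto)
qed

lemma rec_on_unary_rec:
  assumes "rec_on 2 (\<lambda>ys. s (ys ! 0) (ys ! 1))" and "\<And>m. g m = rec_nat c s m" and "rec_on n f"
  shows "rec_on n (\<lambda>xs. g (f xs))"
proof (rule rec_on_comp1[OF _ assms(3)])
  have "rec_on 1 (\<lambda>xs. rec_nat c (\<lambda>k r. s k r) (xs ! 0))"
  proof -
    have "rec_on (1 + 2) (\<lambda>ys. s (ys ! 0) (ys ! 1))"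
      by (rule rec_on_comp2[OF assms(1)]) (auto intro: rec_on_proj)
    from rec_on_rec_nat[OF rec_on_proj rec_on_const this] show ?thesis by simp
  qed
  then show "rec_on 1 (\<lambda>ys. g (ys ! 0))" using assms(2) by simp
qed

lemma rec_on_add:
  assumes "rec_on n f" "rec_on n g" shows "rec_on n (\<lambda>xs. f xs + g xs)"
proof (rule rec_on_comp2[OF _ assms])
  have "rec_on 2 (\<lambda>ys. rec_nat (ys ! 1) (\<lambda>k r. Suc ((k # r # ys) ! 1)) (ys ! 0))"
    by (intro rec_on_rec_nat rec_on_Suc rec_on_proj) auto
  moreover have "rec_nat b (\<lambda>k. Suc) m = m + b" for m b by (induction m) auto
  ultimately show "rec_on 2 (\<lambda>ys. ys ! 0 + ys ! 1)" by simp
qed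

lemma rec_on_mult:
  assumes "rec_on n f" "rec_on n g" shows "rec_on n (\<lambda>xs. f xs * g xs)"
proof (rule rec_on_comp2[OF _ assms])
  have "rec_on 2 (\<lambda>ys. rec_nat 0 (\<lambda>k r. (k # r # ys) ! 1 + (k # r # ys) ! 3) (ys ! 0))"
    by (intro rec_on_rec_nat rec_on_add rec_on_const rec_on_proj) auto
  moreover have "rec_nat 0 (\<lambda>k r. r + b) m = m * b" for m b :: nat by (induction m) auto
  ultimately show "rec_on 2 (\<lambda>ys. ys ! 0 * ys ! 1)" by (simp add: numeral_3_eq_3)
qed

lemma rec_on_power: "rec_on n f \<Longrightarrow> rec_on n (\<lambda>xs. f xs ^ k)"
  by (induction k) (auto intro: rec_on_const rec_on_mult)

lemma rec_on_pred:
  assumes "rec_on n f" shows "rec_on n (\<lambda>xs. f xs - 1)"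
proof (rule rec_on_unary_rec[OF _ _ assms])
  show "rec_on 2 (\<lambda>ys. ys ! 0)" by (rule rec_on_proj) simp
  show "m - 1 = rec_nat 0 (\<lambda>k r. k) m" for m :: nat by (cases m) auto
qed

lemma rec_on_diff:
  assumes "rec_on n f" "rec_on n g" shows "rec_on n (\<lambda>xs. f xs - g xs)"
proof (rule rec_on_comp2[OF _ assms])
  have "rec_on 2 (\<lambda>ys. rec_nat (ys ! 0) (\<lambda>k r. (k # r # ys) ! 1 - 1) (ys ! 1))"
    by (intro rec_on_rec_nat rec_on_pred rec_on_proj) auto
  moreover have "rec_nat b (\<lambda>k r. r - 1) m = b - m" for m b :: nat by (induction m) auto
  ultimately show "rec_on 2 (\<lambda>ys. ys ! 0 - ys ! 1)" by simp
qed

lemma rec_on_if_zero: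
  assumes "rec_on n c" "rec_on n f" "rec_on n g"
  shows "rec_on n (\<lambda>xs. if c xs = 0 then f xs else g xs)"
proof -
  have "rec_on n (\<lambda>xs. (1 - c xs) * f xs + (1 - (1 - c xs)) * g xs)"
    by (intro rec_on_add rec_on_mult rec_on_diff rec_on_const assms)
  moreover have "(1 - c xs) * f xs + (1 - (1 - c xs)) * g xs = (if c xs = 0 then f xs else g xs)" for xs
    by simp
  ultimately show ?thesis by simp
qed

lemma rec_on_triangle:
  assumes "rec_on n f" shows "rec_on n (\<lambda>xs. triangle (f xs))"
proof (rule rec_on_unary_rec[OF _ _ assms])
  show "rec_on 2 (\<lambda>ys. ys ! 1 + Suc (ys ! 0))"
    by (intro rec_on_add rec_on_Suc rec_on_proj) auto
  show "triangle m = rec_nat 0 (\<lambda>k r. r + Suc k) m" for m by (induction m) auto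
qed

lemma rec_on_prod_encode:
  "rec_on n f \<Longrightarrow> rec_on n g \<Longrightarrow> rec_on n (\<lambda>xs. prod_encode (f xs, g xs))"
  unfolding prod_encode_def by (simp add: rec_on_add rec_on_triangle)

lemma triangle_mono: "a \<le> b \<Longrightarrow> triangle a \<le> triangle b"
  by (induction rule: dec_induct) auto

text \<open>As \<open>prod_encode (a, b) = triangle (a + b) + a\<close>, the sum \<open>a + b\<close> is the least \<open>k\<close> such that
  \<open>triangle (k + 1)\<close> exceeds the code, and minimisation finds it.\<close>

lemma rec_on_prod_decode:
  assumes "rec_on n f"
  shows "rec_on n (\<lambda>xs. fst (prod_decode (f xs)))" "rec_on n (\<lambda>xs. snd (prod_decode (f xs)))"
proof -
  let ?w = "\<lambda>z. LEAST k. Suc z - triangle (Suc k) = 0"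
  have w: "?w (prod_encode (a, b)) = a + b" for a b
  proof (rule Least_equality)
    show "Suc (prod_encode (a, b)) - triangle (Suc (a + b)) = 0"
      unfolding prod_encode_def by simp
    fix k assume "Suc (prod_encode (a, b)) - triangle (Suc k) = 0"
    then have "triangle (a + b) < triangle (Suc k)" unfolding prod_encode_def by simp
    then show "a + b \<le> k" using triangle_mono[of "Suc k" "a + b"] by linarith
  qed
  have ex: "\<exists>k. Suc z - triangle (Suc k) = 0" for z by (rule exI[of _ z]) simp
  have "rec_on 1 (\<lambda>xs. LEAST k. Suc ((k # xs) ! 1) - triangle (Suc ((k # xs) ! 0)) = 0)"
    by (rule rec_on_LEAST)
       (use ex in \<open>auto intro!: rec_on_diff rec_on_triangle rec_on_Suc rec_on_proj simp del: triangle_Suc\<close>)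
  then have rw: "rec_on 1 (\<lambda>xs. ?w (xs ! 0))" by simp
  have fst: "fst (prod_decode z) = z - triangle (?w z)"
    and snd: "snd (prod_decode z) = ?w z - (z - triangle (?w z))" for z
  proof -
    obtain a b where z: "z = prod_encode (a, b)" by (metis prod_decode_inverse surj_pair)
    have "z - triangle (a + b) = a" unfolding z prod_encode_def by simp
    then show "fst (prod_decode z) = z - triangle (?w z)"
      "snd (prod_decode z) = ?w z - (z - triangle (?w z))"
      unfolding z w prod_encode_inverse by simp_all
  qed
  show "rec_on n (\<lambda>xs. fst (prod_decode (f xs)))" "rec_on n (\<lambda>xs. snd (prod_decode (f xs)))"
    unfolding fst snd
    by (intro rec_on_diff rec_on_triangle rec_on_comp1[OF rw] assms)+
qed

text \<open>Integers are represented as differences of natural numbers. This makes the ring operations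
  polynomial, so that no case distinction on signs is needed.\<close>

definition int_rec_on :: "nat \<Rightarrow> (nat list \<Rightarrow> int) \<Rightarrow> bool" where
  "int_rec_on n f \<longleftrightarrow> (\<exists>g h. rec_on n g \<and> rec_on n h \<and> (\<forall>xs. f xs = int (g xs) - int (h xs)))"

lemma int_rec_onI: "rec_on n g \<Longrightarrow> rec_on n h \<Longrightarrow> (\<And>xs. f xs = int (g xs) - int (h xs)) \<Longrightarrow> int_rec_on n f"
  unfolding int_rec_on_def by blast

lemma int_rec_on_of_nat: "rec_on n f \<Longrightarrow> int_rec_on n (\<lambda>xs. int (f xs))"
  by (rule int_rec_onI[OF _ rec_on_const[of n 0]]) auto

lemma int_rec_on_const: "int_rec_on n (\<lambda>xs. c)"
  by (rule int_rec_onI[OF rec_on_const[of n "nat c"] rec_on_const[of n "nat (- c)"]]) auto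

lemma int_rec_on_diff:
  assumes "int_rec_on n f" "int_rec_on n g" shows "int_rec_on n (\<lambda>xs. f xs - g xs)"
proof -
  obtain f1 f2 g1 g2 where *: "rec_on n f1" "rec_on n f2" "rec_on n g1" "rec_on n g2"
    "\<And>xs. f xs = int (f1 xs) - int (f2 xs)" "\<And>xs. g xs = int (g1 xs) - int (g2 xs)"
    using assms unfolding int_rec_on_def by metis
  show ?thesis
    by (rule int_rec_onI[OF rec_on_add[OF *(1,4)] rec_on_add[OF *(2,3)]]) (simp add: *(5,6))
qed

lemma int_rec_on_add:
  assumes "int_rec_on n f" "int_rec_on n g" shows "int_rec_on n (\<lambda>xs. f xs + g xs)"
  using int_rec_on_diff[OF assms(1) int_rec_on_diff[OF int_rec_on_const[of n 0] assms(2)]] by simp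

lemma int_rec_on_mult:
  assumes "int_rec_on n f" "int_rec_on n g" shows "int_rec_on n (\<lambda>xs. f xs * g xs)"
proof -
  obtain f1 f2 g1 g2 where *: "rec_on n f1" "rec_on n f2" "rec_on n g1" "rec_on n g2"
    "\<And>xs. f xs = int (f1 xs) - int (f2 xs)" "\<And>xs. g xs = int (g1 xs) - int (g2 xs)"
    using assms unfolding int_rec_on_def by metis
  show ?thesis
    by (rule int_rec_onI[OF rec_on_add[OF rec_on_mult[OF *(1,3)] rec_on_mult[OF *(2,4)]]
           rec_on_add[OF rec_on_mult[OF *(1,4)] rec_on_mult[OF *(2,3)]]])
       (simp add: *(5,6) algebra_simps)
qed

lemma int_rec_on_power: "int_rec_on n f \<Longrightarrow> int_rec_on n (\<lambda>xs. f xs ^ k)"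
  by (induction k) (auto intro: int_rec_on_const int_rec_on_mult)

lemma int_decode_eq:
  "int_decode z = int (if z mod 2 = 0 then z div 2 else 0) - int (if z mod 2 = 0 then 0 else Suc (z div 2))"
  by (auto simp: int_decode_def sum_decode_def even_iff_mod_2_eq_zero odd_iff_mod_2_eq_one)

lemma rec_on_mod2:
  assumes "rec_on n f" shows "rec_on n (\<lambda>xs. f xs mod 2)"
proof (rule rec_on_unary_rec[OF _ _ assms])
  show "rec_on 2 (\<lambda>ys. 1 - ys ! 1)" by (intro rec_on_diff rec_on_const rec_on_proj) auto
  show "m mod 2 = rec_nat 0 (\<lambda>k r. 1 - r) m" for m :: nat
    by (induction m) (auto simp: mod_Suc)
qed

lemma rec_on_div2:
  assumes "rec_on n f" shows "rec_on n (\<lambda>xs. f xs div 2)"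
proof (rule rec_on_unary_rec[OF _ _ assms])
  show "rec_on 2 (\<lambda>ys. ys ! 1 + ys ! 0 mod 2)"
    by (intro rec_on_add rec_on_mod2 rec_on_proj) auto
  show "m div 2 = rec_nat 0 (\<lambda>k r. r + k mod 2) m" for m :: nat
  proof (induction m)
    case (Suc m)
    have "Suc m div 2 = m div 2 + m mod 2" by presburger
    then show ?case using Suc by simp
  qed simp
qed

lemma int_rec_on_int_decode:
  assumes "rec_on n f" shows "int_rec_on n (\<lambda>xs. int_decode (f xs))"
  unfolding int_decode_eq
  by (intro int_rec_on_diff int_rec_on_of_nat rec_on_if_zero rec_on_const rec_on_Suc
        rec_on_mod2 rec_on_div2 assms)

lemma rec_on_if_int_zero:
  assumes "int_rec_on n c" "rec_on n f" "rec_on n g"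
  shows "rec_on n (\<lambda>xs. if c xs = 0 then f xs else g xs)"
proof -
  obtain c1 c2 where c: "rec_on n c1" "rec_on n c2" "\<And>xs. c xs = int (c1 xs) - int (c2 xs)"
    using assms(1) unfolding int_rec_on_def by metis
  have "rec_on n (\<lambda>xs. if (c1 xs - c2 xs) + (c2 xs - c1 xs) = 0 then f xs else g xs)"
    by (intro rec_on_if_zero rec_on_add rec_on_diff c assms)
  moreover have "(c1 xs - c2 xs) + (c2 xs - c1 xs) = 0 \<longleftrightarrow> c xs = 0" for xs
    unfolding c(3) by auto
  ultimately show ?thesis by simp
qed

lemma computableI:
  assumes "rec_on 1 (\<lambda>xs. G (xs ! 0))" "\<And>x. G (code x) = code (f x)"
  shows "computable f"
proof -
  obtain F where F: "recursive 1 F" "\<And>xs. length xs = 1 \<Longrightarrow> F xs = G (xs ! 0)"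
    using assms(1) unfolding rec_on_def by blast
  then show ?thesis unfolding computable_def using assms(2) by (intro exI[of _ F]) auto
qed

text \<open>A list code is built from the last element backwards, so the descending order of the elements
  turns the enumeration into a primitive recursion.\<close>

lemma list_encode_filter_upt:
  "list_encode (map f (filter P (rev [0..<N]))) =
     rec_nat 0 (\<lambda>k r. if P k then Suc (prod_encode (f k, r)) else r) N"
  by (induction N) auto

text \<open>The form in which computability is used: an algorithm that searches all codes below a bound depending
  on its input.\<close>

lemma computable_enumeration:
  fixes f :: "nat \<Rightarrow> 'b :: coded"
  assumes N: "rec_on 1 (\<lambda>ys. N (ys ! 0))" and P: "rec_on 1 (\<lambda>ys. of_bool (P (ys ! 0)))"
    and f: "rec_on 1 (\<lambda>ys. code (f (ys ! 0)))"
  shows "computable (\<lambda>x :: 'a :: coded. map f (filter P (rev [0..<N (code x)])))"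
proof (rule computableI)
  let ?s = "\<lambda>k r. if P k then Suc (prod_encode (code (f k), r)) else r"
  have "rec_on (1 + 2) (\<lambda>ys. if of_bool (P (ys ! 0)) = (0 :: nat) then ys ! 1
      else Suc (prod_encode (code (f (ys ! 0)), ys ! 1)))"
    by (intro rec_on_if_zero rec_on_comp1[OF P] rec_on_comp1[OF f] rec_on_Suc
        rec_on_prod_encode rec_on_proj) auto
  moreover have "(if of_bool (P k) = (0 :: nat) then r else Suc (prod_encode (code (f k), r))) = ?s k r" for k r
    by simp
  ultimately have "rec_on (1 + 2) (\<lambda>ys. ?s (ys ! 0) (ys ! 1))" by simp
  from rec_on_rec_nat[OF N rec_on_const[of 1 0] this]
  show "rec_on 1 (\<lambda>xs. rec_nat 0 ?s (N (xs ! 0)))"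
    by (simp only: nth_Cons_0 One_nat_def nth_Cons_Suc)
  show "rec_nat 0 ?s (N (code x)) = code (map f (filter P (rev [0..<N (code x)])))" for x :: 'a
    unfolding code_list_def map_map list_encode_filter_upt by (simp only: comp_def)
qed

section \<open>Codes of binary quartic forms\<close>

text \<open>The zero polynomial has code 0, so whether \<^const>\<open>pCons\<close> drops its argument can be seen from the codes
  alone. This gives the code of a polynomial as a recursive function of the codes of its coefficients,
  trailing zeros included.\<close>

lemma code_poly_pCons:
  fixes a :: "'a :: {zero, coded}"
  assumes "code (0 :: 'a) = 0"
  shows "code (pCons a p) =
    (if code a + code p = 0 then 0 else Suc (prod_encode (code a, code p)))"
proof -
  have "code a = 0 \<longleftrightarrow> a = 0" using assms by (metis inj_code injD)
  moreover have "code p = 0 \<longleftrightarrow> p = 0" for p :: "'a poly"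
    by (metis code_poly_def code_list_def coeffs_0_eq_Nil list.simps(8) list_encode.simps(1) inj_code injD)
  ultimately show ?thesis
    by (simp add: code_poly_def code_list_def cCons_def)
qed

lemma code_int_0: "code (0::int) = 0"
  by (simp add: code_int_def int_encode_def sum_encode_def)

lemma code_poly_0: "code (0 :: 'a :: {zero, coded} poly) = 0"
  by (simp add: code_poly_def code_list_def)

lemmas code_int_poly_pCons = code_poly_pCons[OF code_int_0]
lemmas code_int_poly2_pCons = code_poly_pCons[OF code_poly_0]

lemma code_int_decode: "code (int_decode k) = k"
  by (simp add: code_int_def)

lemma code_fst_le: "code x \<le> code (x, y)" and code_snd_le: "code y \<le> code (x, y)"
  by (simp_all add: code_prod_def le_prod_encode_1 le_prod_encode_2)

lemma abs_le_code: "\<bar>i\<bar> \<le> int (code i)" and code_le_abs: "int (code i) \<le> 2 * \<bar>i\<bar>"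
  by (auto simp: code_int_def int_encode_def sum_encode_def)

lemma prod_encode_mono: "a \<le> a' \<Longrightarrow> b \<le> b' \<Longrightarrow> prod_encode (a, b) \<le> prod_encode (a', b')"
  unfolding prod_encode_def by (auto intro!: add_mono triangle_mono)

definition pair_decode :: "nat \<Rightarrow> int \<times> int" where
  "pair_decode k = (int_decode (fst (prod_decode k)), int_decode (snd (prod_decode k)))"

lemma code_pair_decode: "code (pair_decode k) = k"
  by (simp add: pair_decode_def code_prod_def code_int_decode)

definition quartic_decode :: "nat \<Rightarrow> int quartic" where
  "quartic_decode k =
     (let u = snd (prod_decode k); v = snd (prod_decode u); w = snd (prod_decode v) in
      (int_decode (fst (prod_decode k)), int_decode (fst (prod_decode u)),
       int_decode (fst (prod_decode v)), pair_decode w))"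

lemma code_quartic_decode: "code (quartic_decode k) = k"
  unfolding quartic_decode_def Let_def code_prod_def[of "(_, _)"] fst_conv snd_conv
    code_int_decode code_pair_decode by simp

lemma quartic_decode_code: "quartic_decode (code F) = F"
  by (rule injD[OF inj_code]) (rule code_quartic_decode)

lemma int_rec_on_disc27:
  assumes "rec_on n f" shows "int_rec_on n (\<lambda>xs. disc27 (quartic_decode (f xs)))"
  unfolding quartic_decode_def pair_decode_def Let_def disc27_def invariant_I.simps invariant_J.simps
  by (intro int_rec_on_add int_rec_on_diff int_rec_on_mult int_rec_on_power int_rec_on_const
        int_rec_on_int_decode rec_on_prod_decode assms)

lemma rec_on_code_binary_form:
  assumes "rec_on n f" shows "rec_on n (\<lambda>xs. code (binary_form (quartic_decode (f xs))))"
  unfolding quartic_decode_def pair_decode_def Let_def binary_form.simps code_int_poly2_pCons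
    code_int_poly_pCons code_int_decode code_int_0 code_poly_0
  by (intro rec_on_if_zero rec_on_add rec_on_const rec_on_Suc rec_on_prod_encode
      rec_on_prod_decode assms)

definition max_code :: "nat \<Rightarrow> nat" where
  "max_code V = prod_encode (V, prod_encode (V, prod_encode (V, prod_encode (V, V))))"

lemma code_le_max_code:
  assumes "height_le B F" "2 * B \<le> int V" shows "code F \<le> max_code V"
proof (cases F rule: prod_cases5)
  case (fields p q r s t)
  have "code i \<le> V" if "\<bar>i\<bar> \<le> B" for i
    using code_le_abs[of i] that assms(2) by linarith
  then have "code p \<le> V" "code q \<le> V" "code r \<le> V" "code s \<le> V" "code t \<le> V"
    using assms(1) unfolding fields by simp_all
  then show ?thesis unfolding fields max_code_def code_prod_def fst_conv snd_conv
    by (intro prod_encode_mono)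
qed

section \<open>The list of Thue equations and the rule for candidates\<close>

text \<open>The bound of \<open>covering_equivalent_to_small\<close> with the code of \<open>(a, b, c)\<close> in place of \<open>h\<close>, which is
  possible because a code dominates the absolute values of the integers it encodes. The factor 18 is
  twice 9, as the code of an integer is at most twice its absolute value.\<close>

definition thue_bound :: "nat \<Rightarrow> nat" where
  "thue_bound h = Suc (max_code (18 * (360 * h ^ 2) ^ 3))"

definition thue_list :: "int \<times> int \<times> int \<Rightarrow> (int poly poly \<times> int) list" where
  "thue_list p = map (\<lambda>k. (binary_form (quartic_decode k), 1))
     (filter (\<lambda>k. disc27 (quartic_decode k) \<noteq> 0) (rev [0..<thue_bound (code p)]))"

text \<open>Twice the bound of \<open>solution_size\<close>, for the same reason, with the code of the whole input in place
  of \<open>w\<close>.\<close>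

definition candidate_bound :: "nat \<Rightarrow> nat" where
  "candidate_bound w = Suc (prod_encode (912 * w ^ 7, 912 * w ^ 7))"

definition candidates :: "(int \<times> int \<times> int) \<times> (int poly poly \<times> int) \<times> (int \<times> int) \<Rightarrow> (int \<times> int) list" where
  "candidates z = map pair_decode (rev [0..<candidate_bound (code z)])"

lemma computable_thue_list: "computable thue_list"
  unfolding thue_list_def
proof (rule computable_enumeration)
  show "rec_on 1 (\<lambda>ys. thue_bound (ys ! 0))"
    unfolding thue_bound_def max_code_def
    by (intro rec_on_Suc rec_on_prod_encode rec_on_mult rec_on_power rec_on_const rec_on_proj) auto
  have "rec_on 1 (\<lambda>ys. if disc27 (quartic_decode (ys ! 0)) = 0 then 0 else 1)"
    by (intro rec_on_if_int_zero int_rec_on_disc27 rec_on_const rec_on_proj) auto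
  moreover have "of_bool (F \<noteq> 0) = (if F = 0 then 0 else 1 :: nat)" for F :: int by simp
  ultimately show "rec_on 1 (\<lambda>ys. of_bool (disc27 (quartic_decode (ys ! 0)) \<noteq> 0))" by simp
  show "rec_on 1 (\<lambda>ys. code (binary_form (quartic_decode (ys ! 0)), 1 :: int))"
    unfolding code_prod_def fst_conv snd_conv
    by (intro rec_on_prod_encode rec_on_code_binary_form rec_on_const rec_on_proj) auto
qed

lemma computable_candidates: "computable candidates"
proof -
  have "computable (\<lambda>z :: (int \<times> int \<times> int) \<times> (int poly poly \<times> int) \<times> (int \<times> int).
      map pair_decode (filter (\<lambda>_. True) (rev [0..<candidate_bound (code z)])))"
  proof (rule computable_enumeration)
    show "rec_on 1 (\<lambda>ys. candidate_bound (ys ! 0))"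
      unfolding candidate_bound_def
      by (intro rec_on_Suc rec_on_prod_encode rec_on_mult rec_on_power rec_on_const rec_on_proj) auto
  qed (simp_all only: code_pair_decode rec_on_const rec_on_proj zero_less_one)
  then show ?thesis unfolding candidates_def[abs_def] by simp
qed

lemma thue_list_quartic_thue: "(g, d) \<in> set (thue_list p) \<Longrightarrow> quartic_thue g d"
  unfolding thue_list_def by (auto intro!: quartic_thue_binary_form)

lemma mem_thue_list:
  assumes "height_le (9 * (360 * int (code p) ^ 2) ^ 3) F" "disc27 F \<noteq> 0"
  shows "(binary_form F, 1) \<in> set (thue_list p)"
proof -
  have "code F < thue_bound (code p)"
    unfolding thue_bound_def less_Suc_eq_le by (rule code_le_max_code[OF assms(1)]) simp
  then have "(binary_form (quartic_decode (code F)), 1) \<in> set (thue_list p)"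
    using assms(2) unfolding thue_list_def set_map by (intro imageI) (simp add: quartic_decode_code)
  then show ?thesis by (simp add: quartic_decode_code)
qed

lemma mem_candidates:
  assumes "\<bar>x\<bar> \<le> 456 * int (code z) ^ 7" "\<bar>y\<bar> \<le> 456 * int (code z) ^ 7"
  shows "(x, y) \<in> set (candidates z)"
proof -
  have "int (code i) \<le> int (912 * code z ^ 7)" if "\<bar>i\<bar> \<le> 456 * int (code z) ^ 7" for i
    using code_le_abs[of i] that by simp
  then have "code (x, y) < candidate_bound (code z)"
    using assms unfolding candidate_bound_def less_Suc_eq_le code_prod_def[of "(x, y)"] fst_conv snd_conv
    by (intro prod_encode_mono) (simp_all only: of_nat_le_iff)
  then have "pair_decode (code (x, y)) \<in> set (candidates z)"
    unfolding candidates_def set_map by (intro imageI) simp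
  moreover have "pair_decode (code (x, y)) = (x, y)"
    by (rule injD[OF inj_code]) (rule code_pair_decode)
  ultimately show ?thesis by simp
qed

text \<open>The code of a polynomial dominates those of its coefficients. Thus the code of the input of
  \<^const>\<open>candidates\<close> bounds the coefficients of the Thue equation as well.\<close>

lemma height_le_code: "height_le (int (code (binary_form F))) F"
proof (cases F rule: prod_cases5)
  case (fields p q r s t)
  have "code a \<le> code (pCons a f)" "code f \<le> code (pCons a f)" for a :: int and f
    by (simp_all add: code_int_poly_pCons le_SucI le_prod_encode_1 le_prod_encode_2)
  moreover have "code a \<le> code (pCons a f)" "code f \<le> code (pCons a f)" for a :: "int poly" and f
    by (simp_all add: code_int_poly2_pCons le_SucI le_prod_encode_1 le_prod_encode_2)
  ultimately have "code p \<le> code (binary_form F)" "code q \<le> code (binary_form F)" "code r \<le> code (binary_form F)"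
     "code s \<le> code (binary_form F)" "code t \<le> code (binary_form F)"
    unfolding fields binary_form.simps by (meson order_trans)+
  then have "\<bar>i\<bar> \<le> int (code (binary_form F))" if "i \<in> {p, q, r, s, t}" for i
    using abs_le_code[of i] that by fastforce
  then show ?thesis unfolding fields by simp
qed

lemma height_le_mono: "height_le B F \<Longrightarrow> B \<le> C \<Longrightarrow> height_le C F"
  by (induction F rule: prod_induct5) auto

theorem theorem5:
  "reduces_to_quartic_thue
     {(a :: int, b :: int, c :: int). a * c * (b\<^sup>2 - 4 * a * c) \<noteq> 0}
     (\<lambda>(a, b, c). {(x :: int, y :: int). y\<^sup>2 = a * x ^ 4 + b * x\<^sup>2 + c})"
  unfolding reduces_to_quartic_thue_def
proof (intro exI conjI ballI)
  show "computable thue_list" by (rule computable_thue_list)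
  show "computable candidates" by (rule computable_candidates)
next
  fix p :: "int \<times> int \<times> int" and e :: "int poly poly \<times> int"
  assume "e \<in> set (thue_list p)"
  then show "case e of (g, d) \<Rightarrow> quartic_thue g d" by (auto intro: thue_list_quartic_thue)
next
  fix p :: "int \<times> int \<times> int" and s :: "int \<times> int"
  assume p: "p \<in> {(a :: int, b :: int, c :: int). a * c * (b\<^sup>2 - 4 * a * c) \<noteq> 0}"
    and s: "s \<in> (case p of (a, b, c) \<Rightarrow> {(x :: int, y :: int). y\<^sup>2 = a * x ^ 4 + b * x\<^sup>2 + c})"
  obtain a b c where abc: "p = (a, b, c)" by (rule prod_cases3)
  obtain x y where xy: "s = (x, y)" by (rule prod.exhaust)
  have nondeg: "a*c*(b^2 - 4*a*c) \<noteq> 0" and curve: "y^2 = a*x^4 + b*x^2 + c"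
    using p s unfolding abc xy by auto
  then have a0: "a \<noteq> 0" by auto
  have le: "code a \<le> code p" "code b \<le> code p" "code c \<le> code p"
    unfolding abc by (meson code_fst_le code_snd_le order_trans)+
  have abs_le: "\<bar>i\<bar> \<le> int N" if "code i \<le> N" for i N using abs_le_code[of i] that by linarith
  note h = le[THEN abs_le]
  have "1 \<le> int (code p)" using a0 h(1) by linarith
  from covering_equivalent_to_small[OF curve nondeg this h]
  obtain i j k l where det: "i*l - j*k = 1"
    and small: "height_le (9 * (360 * int (code p) ^ 2) ^ 3) (subst_quartic i j k l (covering_quartic a b c x y))" .
  define F where "F = subst_quartic i j k l (covering_quartic a b c x y)"
  \<comment> \<open>The solution \<open>(l, - k)\<close> of \<open>F(m, n) = 1\<close> is the inverse image of \<open>(1, 0)\<close>.\<close>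
  define z where "z = (p, (binary_form F, 1::int), (l, - k))"
  have "disc27 F \<noteq> 0" unfolding F_def disc27_subst[OF det] disc27_covering[OF curve]
    using nondeg by (simp only: mult_eq_0_iff power_eq_0_iff zero_neq_numeral simp_thms de_Morgan_disj)
  then have mem: "(binary_form F, 1) \<in> set (thue_list p)"
    by (intro mem_thue_list) (use small F_def in simp)
  have "eval2 (binary_form F) l (- k) = eval_quartic (covering_quartic a b c x y) (i*l + j*(-k)) (k*l + l*(-k))"
    unfolding eval2_binary_form F_def eval_quartic_subst ..
  also have "\<dots> = 1" using det by (simp add: covering_quartic_def)
  finally have one: "eval2 (binary_form F) l (- k) = 1" .
  have zle: "code p \<le> code z" "code (binary_form F) \<le> code z" "code l \<le> code z" "code (- k) \<le> code z"
    unfolding z_def by (meson code_fst_le code_snd_le order_trans)+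
  have hz: "\<bar>a\<bar> \<le> int (code z)" "\<bar>b\<bar> \<le> int (code z)" "\<bar>c\<bar> \<le> int (code z)"
       "\<bar>l\<bar> \<le> int (code z)" "\<bar>k\<bar> \<le> int (code z)"
    using h zle(1) abs_le[OF zle(3)] abs_le[OF zle(4)] by simp_all
  have "height_le (int (code z)) F" by (rule height_le_mono[OF height_le_code]) (use zle in simp)
  from solution_size[OF curve a0 det this[unfolded F_def] hz]
  have "s \<in> set (candidates z)" unfolding xy by (rule mem_candidates)
  then show "\<exists>(g, d)\<in>set (thue_list p). \<exists>m n. eval2 g m n = d \<and> s \<in> set (candidates (p, (g, d), m, n))"
    using mem one unfolding z_def by blast
qed

end
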